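(* Let $d=4$ and let $\mathbb P$ satisfy Assumptions (A1)–(A4) listed in the context. Then for $\mathbb P$-a.e. $\omega$, $$\mathsf P^{2n}_\omega(0,0)=o\bigl(n^{-2}\log n\bigr),\qquad n\to\infty .$$
   Context: Basic setting. Let $\mathbb B(\mathbb Z^d)$ be the set of unordered nearest-neighbor edges of $\mathbb Z^d$ and $\Omega:=(0,1]^{\mathbb B(\mathbb Z^d)}$ with the product $\sigma$-algebra. For $\omega\in\Omega$ write $\omega_{xy}=\omega_{yx}=\omega_b$ for the value at $b=\langle x,y\rangle$. Put $\pi_\omega(x):=\sum_{z:|z-x|=1}\omega_{xz}$ and $\mathsf P_\omega(x,y):=\omega_{xy}/\pi_\omega(x)$ for nearest neighbors $x,y$ (and $0$ otherwise). $(X_n)_{n\ge0}$ is the Markov chain on $\mathbb Z^d$ with transition kernel $\mathsf P_\omega$; $P^x_\omega$ is its law when started at $x$ and $\mathsf P^n_\omega(x,y)=P^x_\omega(X_n=y)$. Shifts: $(\tau_x\omega)_{y,z}:=\omega_{y+x,z+x}$. Strong component. For $\alpha>0$, $\mathscr C_{\infty,\alpha}=\mathscr C_{\infty,\alpha}(\omega)$ is the set of vertices of $\mathbb Z^d$ lying on an infinite self-avoiding path of edges $b$ with $\omega_b\ge\alpha$. For $y\notin\mathscr C_{\infty,\alpha}$ let $\mathcal F_y$ be the connected component (in the graph $\mathbb Z^d$) of $\mathbb Z^d\setminus\mathscr C_{\infty,\alpha}$ containing $y$; for $y\in\mathscr C_{\infty,\alpha}$ let $\mathcal F_y:=\{y\}$.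 Let $\mathcal G_x:=\bigcup_{y:\langle x,y\rangle\in\mathbb B(\mathbb Z^d)}\mathcal F_y$, with cardinality $|\mathcal G_x|$. Coarse-grained walk. When all components of $\mathbb Z^d\setminus\mathscr C_{\infty,\alpha}$ are finite, set $T_0:=0$, $T_{k+1}:=\inf\{n>T_0+\dots+T_k: X_n\in\mathscr C_{\infty,\alpha}\}-(T_0+\dots+T_k)$ and $\hat X_\ell:=X_{T_0+\dots+T_\ell}$. Started in $\mathscr C_{\infty,\alpha}$, $\hat X$ is a Markov chain on $\mathscr C_{\infty,\alpha}$ with kernel $\hat{\mathsf P}_\omega(x,y):=P^x_\omega(X_{T_1}=y)$, whose $n$-th power is $\hat{\mathsf P}^n_\omega$. Let $\mathrm d_\omega(x,y):=\inf\{n\ge0:\hat{\mathsf P}^n_\omega(x,y)>0\}$. Assumptions on the law $\mathbb P$ of $\omega$. (A1) $\mathbb P$ is a probability measure on $\Omega$, (jointly) ergodic with respect to the shifts $(\tau_x)_{x\in\mathbb Z^d}$. (A2) For $\mathbb P$-a.e. $\omega$, $\bigcup_{\alpha>0}\mathscr C_{\infty,\alpha}(\omega)=\mathbb Z^d$. Consequently $\alpha_1:=\inf\{\alpha>0:\mathbb P(0\in\mathscr C_{\infty,\alpha})=0\}>0$, and for $\alpha\in(0,\alpha_1)$ one sets $\mathbb P_\alpha(\cdot):=\mathbb P(\cdot\mid 0\in\mathscr C_{\infty,\alpha})$. (A3) There is $\alpha\in(0,\alpha_1)$ such that $|\mathcal G_0|\in L^p(\mathbb P_\alpha)$ for all $1\le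 p<\infty$. Let $\alpha_2$ be the supremum of such $\alpha\in(0,\alpha_1)$. (A4) There is $\alpha_0\in(0,\alpha_2]$ such that for each $\alpha\in(0,\alpha_0)$ and each $\rho>0$ there is a $\mathbb P_\alpha$-a.s. finite random variable $C=C(\omega)$ such that for $\mathbb P_\alpha$-a.e. $\omega$ and all $n\ge1$, $$\max_{x\in\mathscr C_{\infty,\alpha},\ \mathrm d_\omega(0,x)\le\rho n}\ \sup_{y\in\mathscr C_{\infty,\alpha}}\hat{\mathsf P}^n_\omega(x,y)\le \frac{C(\omega)}{n^{d/2}} .$$ *)

theory Defs
  imports "HOL-Probability.Probability" "HOL-Library.Landau_Symbols"
begin

text \<open>
  The lattice is \<open>int ^ 'd\<close> with dimension \<open>CARD('d)\<close>. Points of the integer lattice are at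
  Euclidean distance 1 iff they are at \<open>\<ell>\<^sup>1\<close>-distance 1. An edge is the set of its two endpoints.
\<close>

definition nn :: "int ^ 'd \<Rightarrow> int ^ 'd \<Rightarrow> bool" where
  "nn x y \<longleftrightarrow> (\<Sum>i\<in>UNIV. \<bar>x $ i - y $ i\<bar>) = 1"

definition bonds :: "(int ^ 'd) set set" where
  "bonds = {{x, y} | x y. nn x y}"

type_synonym 'd env = "(int ^ 'd) set \<Rightarrow> real"

text \<open>The space of environments \<open>(0,1]\<^sup>B\<close> with the product \<open>\<sigma>\<close>-algebra; the measure carried by
  this object plays no role.\<close>

definition env_space :: "('d::finite) env measure" where
  "env_space = PiM bonds (\<lambda>_. restrict_space borel {0<..1})"

definition shift :: "int ^ 'd \<Rightarrow> 'd env \<Rightarrow> 'd env" where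
  "shift x \<omega> = (\<lambda>b\<in>bonds. \<omega> ((\<lambda>y. y + x) ` b))"

definition conductance_sum :: "('d::finite) env \<Rightarrow> int ^ 'd \<Rightarrow> real" where
  "conductance_sum \<omega> x = (\<Sum>z | nn x z. \<omega> {x, z})"

definition trans_prob :: "('d::finite) env \<Rightarrow> int ^ 'd \<Rightarrow> int ^ 'd \<Rightarrow> real" where
  "trans_prob \<omega> x y = (if nn x y then \<omega> {x, y} / conductance_sum \<omega> x else 0)"

text \<open>
  The law \<open>P\<^sup>x\<^sub>\<omega>\<close> of the Markov chain started at \<open>x\<close>, as a measure on trajectories, is obtained from
  the Ionescu-Tulcea construction: the law of \<open>X\<^sub>0\<close> is the point mass at \<open>x\<close>, and
  given \<open>X\<^sub>0, \<dots>, X\<^sub>n\<close> the law of \<open>X\<^bsub>n+1\<^esub>\<close> has weights \<open>trans_prob \<omega> (X\<^sub>n)\<close>.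
\<close>

fun step_kernel :: "('d::finite) env \<Rightarrow> int ^ 'd \<Rightarrow> nat \<Rightarrow> (nat \<Rightarrow> int ^ 'd) \<Rightarrow> (int ^ 'd) measure" where
  "step_kernel \<omega> x 0 X = return (count_space UNIV) x"
| "step_kernel \<omega> x (Suc n) X = point_measure UNIV (\<lambda>y. ennreal (trans_prob \<omega> (X n) y))"

definition walk_law :: "('d::finite) env \<Rightarrow> int ^ 'd \<Rightarrow> (nat \<Rightarrow> int ^ 'd) measure" where
  "walk_law \<omega> x = projective_family.lim UNIV
     (Ionescu_Tulcea.CI (step_kernel \<omega> x) (\<lambda>_. count_space UNIV)) (\<lambda>_. count_space UNIV)"

definition heat_kernel :: "('d::finite) env \<Rightarrow> nat \<Rightarrow> int ^ 'd \<Rightarrow> int ^ 'd \<Rightarrow> real" where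
  "heat_kernel \<omega> n x y = measure (walk_law \<omega> x) {X \<in> space (walk_law \<omega> x). X n = y}"

definition strong_comp :: "real \<Rightarrow> ('d::finite) env \<Rightarrow> (int ^ 'd) set" where
  "strong_comp \<alpha> \<omega> = {x. \<exists>\<gamma> :: nat \<Rightarrow> int ^ 'd. inj \<gamma> \<and> x \<in> range \<gamma> \<and>
     (\<forall>k. {\<gamma> k, \<gamma> (Suc k)} \<in> bonds \<and> \<omega> {\<gamma> k, \<gamma> (Suc k)} \<ge> \<alpha>)}"

definition hole :: "real \<Rightarrow> ('d::finite) env \<Rightarrow> int ^ 'd \<Rightarrow> (int ^ 'd) set" where
  "hole \<alpha> \<omega> y = (if y \<in> strong_comp \<alpha> \<omega> then {y}
     else {z. (y, z) \<in> {(u, v). nn u v \<and> u \<notin> strong_comp \<alpha> \<omega> \<and> v \<notin> strong_comp \<alpha> \<omega>}\<^sup>*})"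

definition hole_nbhd :: "real \<Rightarrow> ('d::finite) env \<Rightarrow> int ^ 'd \<Rightarrow> (int ^ 'd) set" where
  "hole_nbhd \<alpha> \<omega> x = (\<Union>y\<in>{y. nn x y}. hole \<alpha> \<omega> y)"

text \<open>The time \<open>T\<^sub>1\<close>, with value \<open>\<infinity>\<close> if the set is never hit at a positive time.\<close>

definition return_time :: "(int ^ 'd) set \<Rightarrow> (nat \<Rightarrow> int ^ 'd) \<Rightarrow> enat" where
  "return_time S X = Inf (enat ` {n. n > 0 \<and> X n \<in> S})"

definition coarse_prob :: "real \<Rightarrow> ('d::finite) env \<Rightarrow> int ^ 'd \<Rightarrow> int ^ 'd \<Rightarrow> real" where
  "coarse_prob \<alpha> \<omega> x y = measure (walk_law \<omega> x)
     {X \<in> space (walk_law \<omega> x). \<exists>n. return_time (strong_comp \<alpha> \<omega>) X = enat n \<and> X n = y}"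

fun coarse_kernel :: "real \<Rightarrow> ('d::finite) env \<Rightarrow> nat \<Rightarrow> int ^ 'd \<Rightarrow> int ^ 'd \<Rightarrow> real" where
  "coarse_kernel \<alpha> \<omega> 0 x y = (if x = y then 1 else 0)"
| "coarse_kernel \<alpha> \<omega> (Suc n) x y =
     (\<Sum>\<^sub>\<infinity>z\<in>strong_comp \<alpha> \<omega>. coarse_prob \<alpha> \<omega> x z * coarse_kernel \<alpha> \<omega> n z y)"

definition coarse_dist :: "real \<Rightarrow> ('d::finite) env \<Rightarrow> int ^ 'd \<Rightarrow> int ^ 'd \<Rightarrow> enat" where
  "coarse_dist \<alpha> \<omega> x y = Inf (enat ` {n. coarse_kernel \<alpha> \<omega> n x y > 0})"

definition A1 :: "('d::finite) env measure \<Rightarrow> bool" where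
  "A1 P \<longleftrightarrow> prob_space P \<and> sets P = sets env_space \<and>
     (\<forall>x. distr P P (shift x) = P) \<and>
     (\<forall>A\<in>sets P. (\<forall>x. shift x -` A \<inter> space P = A) \<longrightarrow> measure P A = 0 \<or> measure P A = 1)"

definition A2 :: "('d::finite) env measure \<Rightarrow> bool" where
  "A2 P \<longleftrightarrow> (AE \<omega> in P. (\<Union>\<alpha>\<in>{0<..}. strong_comp \<alpha> \<omega>) = UNIV)"

definition alpha1 :: "('d::finite) env measure \<Rightarrow> real" where
  "alpha1 P = Inf {\<alpha>. \<alpha> > 0 \<and> measure P {\<omega> \<in> space P. 0 \<in> strong_comp \<alpha> \<omega>} = 0}"

definition cond_law :: "('d::finite) env measure \<Rightarrow> real \<Rightarrow> 'd env measure" where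
  "cond_law P \<alpha> = uniform_measure P {\<omega> \<in> space P. 0 \<in> strong_comp \<alpha> \<omega>}"

text \<open>Since \<open>card\<close> is 0 on infinite sets, almost sure finiteness of the cardinality has to be
  required separately.\<close>

definition moment_cond :: "('d::finite) env measure \<Rightarrow> real \<Rightarrow> bool" where
  "moment_cond P \<alpha> \<longleftrightarrow>
     (AE \<omega> in cond_law P \<alpha>. finite (hole_nbhd \<alpha> \<omega> 0)) \<and>
     (\<forall>p\<ge>1. integrable (cond_law P \<alpha>) (\<lambda>\<omega>. real (card (hole_nbhd \<alpha> \<omega> 0)) powr p))"

definition A3 :: "('d::finite) env measure \<Rightarrow> bool" where
  "A3 P \<longleftrightarrow> (\<exists>\<alpha>\<in>{0<..<alpha1 P}. moment_cond P \<alpha>)"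

definition alpha2 :: "('d::finite) env measure \<Rightarrow> real" where
  "alpha2 P = Sup {\<alpha> \<in> {0<..<alpha1 P}. moment_cond P \<alpha>}"

definition A4 :: "('d::finite) env measure \<Rightarrow> bool" where
  "A4 P \<longleftrightarrow> (\<exists>\<alpha>\<^sub>0\<in>{0<..alpha2 P}. \<forall>\<alpha>\<in>{0<..<\<alpha>\<^sub>0}. \<forall>\<rho>>0.
     \<exists>C \<in> borel_measurable (cond_law P \<alpha>). AE \<omega> in cond_law P \<alpha>. \<forall>n\<ge>1.
       \<forall>x\<in>strong_comp \<alpha> \<omega>. ereal_of_enat (coarse_dist \<alpha> \<omega> 0 x) \<le> ereal (\<rho> * real n) \<longrightarrow>
         (\<forall>y\<in>strong_comp \<alpha> \<omega>.
            coarse_kernel \<alpha> \<omega> n x y \<le> C \<omega> / real n powr (real CARD('d) / 2)))"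

end

theory Submission
  imports Defs
begin

text \<open>
  Fix a small \<open>\<alpha>\<close>, let \<open>S\<close> be the strong component, assume \<open>0 \<in> S\<close>, and decompose a return to \<open>0\<close>
  into \<open>l\<close> steps of the walk induced on \<open>S\<close>, of total duration \<open>T\<^sub>1 + \<dots> + T\<^sub>l\<close>. Even return
  probabilities decrease, so \<open>n P\<^sup>4\<^sup>n(0,0)\<close> is at most the sum over \<open>1 \<le> l \<le> 4n\<close> of the
  probabilities that the induced walk is at \<open>0\<close> after \<open>l\<close> steps and that
  \<open>2n < T\<^sub>1 + \<dots> + T\<^sub>l \<le> 4n\<close>. For \<open>l > n/K\<close> assumption A4 bounds each of them by \<open>C K\<^sup>2 / n\<^sup>2\<close>.
  For \<open>l \<le> n/K\<close> the duration exceeds \<open>l K\<close> by at least \<open>n\<close>, so by Markov's inequality it is enough to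
  bound the mean of \<open>(T\<^sub>1 - K)\<^sup>+ + \<dots> + (T\<^sub>l - K)\<^sup>+\<close> on the event of a return. Reversibility moves the long
  step into the first half of the path, and A4 applied to the second half gives \<open>C l\<^sup>-\<^sup>2\<close> times the
  sum over \<open>j < l\<close> of the means of \<open>\<phi>\<^sub>K\<close> at the \<open>j\<close>-th position, where \<open>\<phi>\<^sub>K(x)\<close> is the mean of
  \<open>(T\<^sub>1 - K)\<^sup>+\<close> from \<open>x\<close>. By mass transport, Kac's formula shows that \<open>\<phi>\<^sub>0\<close> is integrable for the
  stationary law of the environment seen from the induced walk, so the maximal ergodic inequality
  yields, for a typical environment and every \<open>\<epsilon> > 0\<close>, some \<open>K\<close> for which this sum is at most \<open>\<epsilon> l\<close> for
  all \<open>l\<close>. Summing \<open>C \<epsilon> / (n l)\<close> over \<open>l \<le> n\<close> gives \<open>C \<epsilon> log n / n\<close>.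
\<close>

section \<open>Nonnegative matrices over a countable index set\<close>

text \<open>Sums in [0, infinity] are integrals against counting measure, so interchange and
  monotone convergence come without summability conditions.\<close>

abbreviation nsum :: "('a \<Rightarrow> ennreal) \<Rightarrow> ennreal" where
  "nsum f \<equiv> \<integral>\<^sup>+ x. f x \<partial>count_space UNIV"

lemma nsum_swap:
  fixes f :: "'a \<Rightarrow> 'b::countable \<Rightarrow> ennreal"
  shows "nsum (\<lambda>x. nsum (\<lambda>y. f x y)) = nsum (\<lambda>y. nsum (\<lambda>x. f x y))"
  by (rule nn_integral_count_space_nn_integral) auto

lemma nsum_cmult: "nsum (\<lambda>x. c * f x) = c * nsum f"
  by (rule nn_integral_cmult) simp

lemma nsum_multc: "nsum (\<lambda>x. f x * c) = nsum f * c"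
  by (rule nn_integral_multc) simp

lemma nsum_add: "nsum (\<lambda>x. f x + g x) = nsum f + nsum g"
  by (rule nn_integral_add) simp_all

lemma nsum_sum: "nsum (\<lambda>x. \<Sum>i\<in>I. f i x) = (\<Sum>i\<in>I. nsum (f i))"
  by (rule nn_integral_sum) simp

lemma nsum_ge_point: "f x \<le> nsum f"
  by (rule nn_integral_ge_point) simp

lemma nsum_delta: "nsum (\<lambda>x. if x = a then f x else 0) = f a"
proof -
  have "nsum (\<lambda>x. if x = a then f x else 0) = (\<integral>\<^sup>+x. f a * indicator {a} x \<partial>count_space UNIV)"
    by (intro nn_integral_cong) (auto split: split_indicator)
  then show ?thesis by (simp add: nn_integral_cmult)
qed

lemma nsum_mono: "(\<And>x. f x \<le> g x) \<Longrightarrow> nsum f \<le> nsum g"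
  by (rule nn_integral_mono) simp

text \<open>Reindexing by n = k + 1 + m. The shift by one fits the convention that index k stands
  for duration k + 1, so a first step of index k leaves n - k - 1 units of time.\<close>

lemma nsum_convolution:
  "nsum (\<lambda>n. \<Sum>k<n. f k (n - Suc k)) = nsum (\<lambda>k. nsum (\<lambda>m. f k m))"
proof -
  have *: "(\<Sum>k<n. f k (n - Suc k)) = nsum (\<lambda>k. nsum (\<lambda>m. if n = Suc k + m then f k m else 0))"
    for n :: nat
  proof -
    have "nsum (\<lambda>m. if n = Suc k + m then f k m else 0) = (if k < n then f k (n - Suc k) else 0)" for k
    proof (cases "k < n")
      case True
      then have "(\<lambda>m. if n = Suc k + m then f k m else 0) = (\<lambda>m. if m = n - Suc k then f k m else 0)"
        by (intro ext) auto
      with True show ?thesis by (simp only: nsum_delta) simp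
    next
      case False
      then have "(\<lambda>m. if n = Suc k + m then f k m else 0) = (\<lambda>m. 0)" by auto
      with False show ?thesis by simp
    qed
    then have "nsum (\<lambda>k. nsum (\<lambda>m. if n = Suc k + m then f k m else 0))
        = nsum (\<lambda>k. if k < n then f k (n - Suc k) else 0)" by simp
    also have "\<dots> = (\<Sum>k\<in>{..<n}. if k < n then f k (n - Suc k) else 0)"
      by (rule nn_integral_count_space') auto
    finally show ?thesis by simp
  qed
  have "nsum (\<lambda>n. \<Sum>k<n. f k (n - Suc k))
      = nsum (\<lambda>n. nsum (\<lambda>k. nsum (\<lambda>m. if n = Suc k + m then f k m else 0)))"
    by (simp only: *)
  also have "\<dots> = nsum (\<lambda>k. nsum (\<lambda>n. nsum (\<lambda>m. if n = Suc k + m then f k m else 0)))"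
    by (rule nsum_swap)
  also have "\<dots> = nsum (\<lambda>k. nsum (\<lambda>m. nsum (\<lambda>n. if n = Suc k + m then f k m else 0)))"
    by (intro nn_integral_cong nsum_swap)
  also have "\<dots> = nsum (\<lambda>k. nsum (\<lambda>m. f k m))"
    by (intro nn_integral_cong nsum_delta)
  finally show ?thesis .
qed

section \<open>Matrix products and powers\<close>

definition mmul :: "('a \<Rightarrow> 'a \<Rightarrow> ennreal) \<Rightarrow> ('a \<Rightarrow> 'a \<Rightarrow> ennreal) \<Rightarrow> 'a \<Rightarrow> 'a \<Rightarrow> ennreal" where
  "mmul A B x y = nsum (\<lambda>z. A x z * B z y)"

fun mpow :: "('a \<Rightarrow> 'a \<Rightarrow> ennreal) \<Rightarrow> nat \<Rightarrow> 'a \<Rightarrow> 'a \<Rightarrow> ennreal" where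
  "mpow A 0 = (\<lambda>x y. if x = y then 1 else 0)"
| "mpow A (Suc n) = mmul A (mpow A n)"

lemma mmul_apply:
  fixes A :: "'a::countable \<Rightarrow> 'a \<Rightarrow> ennreal"
  shows "nsum (\<lambda>y. mmul A B x y * f y) = nsum (\<lambda>z. A x z * nsum (\<lambda>y. B z y * f y))"
proof -
  have "nsum (\<lambda>y. mmul A B x y * f y) = nsum (\<lambda>y. nsum (\<lambda>z. A x z * B z y * f y))"
    by (simp add: mmul_def nsum_multc)
  also have "\<dots> = nsum (\<lambda>z. nsum (\<lambda>y. A x z * B z y * f y))"
    by (rule nsum_swap)
  finally show ?thesis by (simp add: nsum_cmult mult.assoc)
qed

lemma mmul_assoc:
  fixes A :: "'a::countable \<Rightarrow> 'a \<Rightarrow> ennreal"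
  shows "mmul (mmul A B) D = mmul A (mmul B D)"
  by (intro ext) (simp add: mmul_def[of _ D] mmul_def[of A "mmul B D"] mmul_apply)

lemma mmul_one [simp]: "mmul (mpow A 0) B = B" "mmul B (mpow A 0) = B"
proof (intro ext)
  fix x y
  have "mmul (mpow A 0) B x y = nsum (\<lambda>z. if z = x then B z y else 0)"
    unfolding mmul_def by (intro nn_integral_cong) auto
  then show "mmul (mpow A 0) B x y = B x y" by (simp only: nsum_delta)
next
  show "mmul B (mpow A 0) = B"
  proof (intro ext)
    fix x y
    have "mmul B (mpow A 0) x y = nsum (\<lambda>z. if z = y then B x z else 0)"
      unfolding mmul_def by (intro nn_integral_cong) auto
    then show "mmul B (mpow A 0) x y = B x y" by (simp only: nsum_delta)
  qed
qed

lemma mpow_add: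
  fixes A :: "'a::countable \<Rightarrow> 'a \<Rightarrow> ennreal"
  shows "mpow A (m + n) = mmul (mpow A m) (mpow A n)"
proof (induction m)
  case 0
  show ?case by (simp del: mpow.simps)
next
  case (Suc m)
  then show ?case by (simp add: mmul_assoc)
qed

lemma mpow_1 [simp]: "mpow A (Suc 0) = A"
  using mmul_one(2)[of A A] by (simp del: mpow.simps(1))

lemma mpow_Suc2:
  fixes A :: "'a::countable \<Rightarrow> 'a \<Rightarrow> ennreal"
  shows "mpow A (Suc n) = mmul (mpow A n) A"
  using mpow_add[of A n "Suc 0"] by (simp only: mpow_1 add_Suc_right add_0_right)

lemma mmul_add_left: "mmul (\<lambda>x y. A x y + B x y) D x y = mmul A D x y + mmul B D x y"
  by (simp add: mmul_def distrib_right nsum_add)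

lemma mmul_sum_right: "mmul A (\<lambda>x y. \<Sum>i\<in>I. B i x y) x y = (\<Sum>i\<in>I. mmul A (B i) x y)"
  by (simp add: mmul_def sum_distrib_left nsum_sum)

lemma mmul_sum_left: "mmul (\<lambda>x y. \<Sum>i\<in>I. B i x y) A x y = (\<Sum>i\<in>I. mmul (B i) A x y)"
  by (simp add: mmul_def sum_distrib_right nsum_sum)

lemma mmul_nsum_left:
  fixes A :: "'a \<Rightarrow> 'a \<Rightarrow> ennreal" and B :: "'i::countable \<Rightarrow> 'a \<Rightarrow> 'a \<Rightarrow> ennreal"
  shows "mmul (\<lambda>x y. nsum (\<lambda>i. B i x y)) A x y = nsum (\<lambda>i. mmul (B i) A x y)"
  unfolding mmul_def nsum_multc[symmetric] by (rule nsum_swap)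

lemma mmul_nsum_right:
  fixes A :: "'a \<Rightarrow> 'a \<Rightarrow> ennreal" and B :: "'i::countable \<Rightarrow> 'a \<Rightarrow> 'a \<Rightarrow> ennreal"
  shows "mmul A (\<lambda>x y. nsum (\<lambda>i. B i x y)) x y = nsum (\<lambda>i. mmul A (B i) x y)"
  unfolding mmul_def nsum_cmult[symmetric] by (rule nsum_swap)

lemma mmul_mono: "(\<And>z. A x z \<le> A' x z) \<Longrightarrow> (\<And>z. B z y \<le> B' z y) \<Longrightarrow> mmul A B x y \<le> mmul A' B' x y"
  unfolding mmul_def by (intro nsum_mono mult_mono) auto

lemma mmul_row_sum:
  fixes A :: "'a::countable \<Rightarrow> 'a \<Rightarrow> ennreal"
  shows "nsum (mmul A B x) = nsum (\<lambda>z. A x z * nsum (B z))"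
  using mmul_apply[of A B x "\<lambda>_. 1"] by simp

lemma mpow_row_sum_le:
  fixes A :: "'a::countable \<Rightarrow> 'a \<Rightarrow> ennreal"
  assumes "\<And>x. nsum (A x) \<le> 1"
  shows "nsum (mpow A n x) \<le> 1"
proof (induction n arbitrary: x)
  case 0
  have "nsum (mpow A 0 x) = nsum (\<lambda>y. if y = x then 1 else 0)"
    by (intro nn_integral_cong) auto
  then show ?case by (simp only: nsum_delta)
next
  case (Suc n)
  have "nsum (mpow A (Suc n) x) \<le> nsum (\<lambda>z. A x z * 1)"
    by (simp only: mpow.simps mmul_row_sum) (intro nsum_mono mult_left_mono Suc, simp)
  with assms[of x] show ?case by simp
qed

section \<open>Detailed balance\<close>

definition reversible :: "('a \<Rightarrow> ennreal) \<Rightarrow> ('a \<Rightarrow> 'a \<Rightarrow> ennreal) \<Rightarrow> bool" where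
  "reversible w A \<longleftrightarrow> (\<forall>x y. w x * A x y = w y * A y x)"

text \<open>Time reversal swaps the order of the factors; when they do not commute, the product
  itself need not satisfy detailed balance.\<close>

lemma reversible_mmul:
  assumes "reversible w A" "reversible w B"
  shows "w x * mmul A B x y = w y * mmul B A y x"
proof -
  have "w x * (A x z * B z y) = w y * (B y z * A z x)" for z
  proof -
    have "w x * (A x z * B z y) = w z * A z x * B z y"
      using assms(1) unfolding reversible_def by (metis mult.assoc)
    also have "\<dots> = (w z * B z y) * A z x" by (simp add: ac_simps)
    also have "\<dots> = w y * B y z * A z x"
      using assms(2) unfolding reversible_def by metis
    finally show ?thesis by (simp add: mult.assoc)
  qed
  then show ?thesis by (simp add: mmul_def nsum_cmult[symmetric])
qed

lemma reversible_mpow: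
  fixes A :: "'a::countable \<Rightarrow> 'a \<Rightarrow> ennreal"
  assumes "reversible w A"
  shows "reversible w (mpow A n)"
proof (induction n)
  case 0
  show ?case by (auto simp: reversible_def)
next
  case (Suc n)
  show ?case
    unfolding reversible_def
  proof (intro allI)
    fix x y
    show "w x * mpow A (Suc n) x y = w y * mpow A (Suc n) y x"
      using reversible_mmul[OF assms Suc, of x y] by (simp only: mpow_Suc2[symmetric]) simp
  qed
qed

lemma reversible_nsum:
  assumes "\<And>i. reversible w (A i)"
  shows "reversible w (\<lambda>x y. nsum (\<lambda>i. c i * A i x y))"
  unfolding reversible_def
proof (intro allI)
  fix x y
  have "w x * (c i * A i x y) = w y * (c i * A i y x)" for i
    using assms[of i] unfolding reversible_def by (metis mult.left_commute)
  then show "w x * nsum (\<lambda>i. c i * A i x y) = w y * nsum (\<lambda>i. c i * A i y x)"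
    by (simp add: nsum_cmult[symmetric])
qed

section \<open>The walk induced on a set of states\<close>

definition avoid :: "('a \<Rightarrow> 'a \<Rightarrow> ennreal) \<Rightarrow> 'a set \<Rightarrow> 'a \<Rightarrow> 'a \<Rightarrow> ennreal" where
  "avoid p S x y = p x y * indicator (- S) y"

text \<open>The index \<open>n\<close> of \<open>taboo\<close>, \<open>hit\<close>, \<open>enter_prob\<close> and \<open>leave_prob\<close> stands for time \<open>n + 1\<close>. The entry
  \<open>clock p S l n x y\<close> is the probability of \<open>l\<close> induced steps from \<open>x\<close> to \<open>y\<close> of total duration \<open>n\<close>, and
  \<open>excess\<close> relies on the truncated subtraction of natural numbers.\<close>

definition taboo :: "('a \<Rightarrow> 'a \<Rightarrow> ennreal) \<Rightarrow> 'a set \<Rightarrow> nat \<Rightarrow> 'a \<Rightarrow> 'a \<Rightarrow> ennreal" where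
  "taboo p S n = mmul (mpow (avoid p S) n) p"

definition hit :: "('a \<Rightarrow> 'a \<Rightarrow> ennreal) \<Rightarrow> 'a set \<Rightarrow> nat \<Rightarrow> 'a \<Rightarrow> 'a \<Rightarrow> ennreal" where
  "hit p S n x y = indicator S x * (taboo p S n x y * indicator S y)"

fun clock :: "('a \<Rightarrow> 'a \<Rightarrow> ennreal) \<Rightarrow> 'a set \<Rightarrow> nat \<Rightarrow> nat \<Rightarrow> 'a \<Rightarrow> 'a \<Rightarrow> ennreal" where
  "clock p S 0 n x y = (if n = 0 \<and> x = y then 1 else 0)"
| "clock p S (Suc l) n x y = (\<Sum>k<n. mmul (hit p S k) (clock p S l (n - Suc k)) x y)"

definition induced :: "('a \<Rightarrow> 'a \<Rightarrow> ennreal) \<Rightarrow> 'a set \<Rightarrow> 'a \<Rightarrow> 'a \<Rightarrow> ennreal" where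
  "induced p S x y = nsum (\<lambda>k. hit p S k x y)"

definition excess :: "('a \<Rightarrow> 'a \<Rightarrow> ennreal) \<Rightarrow> 'a set \<Rightarrow> nat \<Rightarrow> 'a \<Rightarrow> 'a \<Rightarrow> ennreal" where
  "excess p S K x y = nsum (\<lambda>k. of_nat (Suc k - K) * hit p S k x y)"

text \<open>Mean of \<open>(T_1 - K)^+ + ... + (T_l - K)^+\<close> over l induced steps from x that
  end at y. The recursion looks at the first step: either it supplies the excess or a later step
  does.\<close>

fun excess_sum :: "('a \<Rightarrow> 'a \<Rightarrow> ennreal) \<Rightarrow> 'a set \<Rightarrow> nat \<Rightarrow> nat \<Rightarrow> 'a \<Rightarrow> 'a \<Rightarrow> ennreal" where
  "excess_sum p S K 0 x y = 0"
| "excess_sum p S K (Suc l) x y = mmul (excess p S K) (mpow (induced p S) l) x y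
     + mmul (induced p S) (excess_sum p S K l) x y"

lemma taboo_0 [simp]: "taboo p S 0 = p"
  by (simp add: taboo_def del: mpow.simps(1))

lemma taboo_Suc:
  fixes p :: "'a::countable \<Rightarrow> 'a \<Rightarrow> ennreal"
  shows "taboo p S (Suc n) = mmul (avoid p S) (taboo p S n)"
  by (simp add: taboo_def mmul_assoc)

text \<open>Cuts at the last step, where \<open>taboo_Suc\<close> cuts at the first. Time reversal
  exchanges the two cuts, which is how \<open>reversible_taboo\<close> proceeds.\<close>

lemma taboo_Suc2:
  fixes p :: "'a::countable \<Rightarrow> 'a \<Rightarrow> ennreal"
  shows "taboo p S (Suc n) = mmul (\<lambda>x z. taboo p S n x z * indicator (- S) z) p"
proof -
  have "mmul (mpow (avoid p S) n) (avoid p S) = (\<lambda>x z. taboo p S n x z * indicator (- S) z)"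
    by (intro ext) (simp add: mmul_def avoid_def taboo_def mult.assoc[symmetric] nsum_multc)
  then show ?thesis
    unfolding taboo_def[of p S "Suc n"] mpow_Suc2 by simp
qed

lemma reversible_taboo:
  fixes p :: "'a::countable \<Rightarrow> 'a \<Rightarrow> ennreal"
  assumes "reversible w p"
  shows "reversible w (taboo p S n)"
proof (induction n)
  case 0
  with assms show ?case by simp
next
  case (Suc n)
  show ?case
    unfolding reversible_def
  proof (intro allI)
    fix x y
    have "w x * (avoid p S x z * taboo p S n z y)
        = w y * (taboo p S n y z * indicator (- S) z * p z x)" for z
    proof -
      have "w x * (avoid p S x z * taboo p S n z y)
          = (w x * p x z) * (indicator (- S) z * taboo p S n z y)"
        by (simp add: avoid_def ac_simps)
      also have "w x * p x z = w z * p z x"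
        using assms by (simp add: reversible_def)
      also have "w z * p z x * (indicator (- S) z * taboo p S n z y)
          = (w z * taboo p S n z y) * (indicator (- S) z * p z x)"
        by (simp add: ac_simps)
      also have "w z * taboo p S n z y = w y * taboo p S n y z"
        using Suc by (simp add: reversible_def)
      finally show ?thesis by (simp add: ac_simps)
    qed
    note eq = this
    have "w x * taboo p S (Suc n) x y = nsum (\<lambda>z. w x * (avoid p S x z * taboo p S n z y))"
      by (simp only: taboo_Suc mmul_def nsum_cmult)
    also have "\<dots> = nsum (\<lambda>z. w y * (taboo p S n y z * indicator (- S) z * p z x))"
      by (simp only: eq)
    also have "\<dots> = w y * taboo p S (Suc n) y x"
      by (simp only: taboo_Suc2 mmul_def nsum_cmult)
    finally show "w x * taboo p S (Suc n) x y = w y * taboo p S (Suc n) y x" .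
  qed
qed

text \<open>Detailed balance survives because \<open>hit\<close> restricts both endpoints to S, the
  starting point included.\<close>

lemma reversible_hit:
  fixes p :: "'a::countable \<Rightarrow> 'a \<Rightarrow> ennreal"
  assumes "reversible w p"
  shows "reversible w (hit p S n)"
  using reversible_taboo[OF assms, of S n]
  by (auto simp: reversible_def hit_def split: split_indicator)

lemma reversible_induced:
  fixes p :: "'a::countable \<Rightarrow> 'a \<Rightarrow> ennreal"
  assumes "reversible w p"
  shows "reversible w (induced p S)"
  using reversible_nsum[OF reversible_hit[OF assms], of "\<lambda>_. 1"]
  by (simp add: induced_def[abs_def])

lemma reversible_excess:
  fixes p :: "'a::countable \<Rightarrow> 'a \<Rightarrow> ennreal"
  assumes "reversible w p"
  shows "reversible w (excess p S K)"
  using reversible_nsum[OF reversible_hit[OF assms], of "\<lambda>k. of_nat (Suc k - K)"]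
  by (simp add: excess_def[abs_def])

text \<open>Cut at the first visit to S at a positive time: either it occurs at time k + 1 for some
  k < n, leaving n - k steps, or S is avoided at times 1 to n.\<close>

lemma mpow_first_passage:
  fixes p :: "'a::countable \<Rightarrow> 'a \<Rightarrow> ennreal"
  shows "mpow p (Suc n) x y = taboo p S n x y
    + (\<Sum>k<n. mmul (\<lambda>x z. taboo p S k x z * indicator S z) (mpow p (n - k)) x y)"
proof (induction n arbitrary: x y)
  case 0
  show ?case by (simp del: mpow.simps)
next
  case (Suc n)
  let ?t = "\<lambda>k x z. taboo p S k x z * indicator S z"
  \<comment> \<open>The point at time n + 1 becomes an inner point of the path. It lies either in S,
    which is a new first visit, or outside.\<close>
  have split: "taboo p S n = (\<lambda>x z. taboo p S n x z * indicator (- S) z + ?t n x z)"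
    by (intro ext) (auto split: split_indicator)
  have "mpow p (Suc (Suc n)) x y = mmul (mpow p (Suc n)) p x y"
    by (simp only: mpow_Suc2[of p "Suc n"])
  also have "mpow p (Suc n) = (\<lambda>x y. taboo p S n x y + (\<Sum>k<n. mmul (?t k) (mpow p (n - k)) x y))"
    by (intro ext) (rule Suc)
  also have "mmul \<dots> p x y = mmul (taboo p S n) p x y
      + (\<Sum>k<n. mmul (mmul (?t k) (mpow p (n - k))) p x y)"
    by (simp only: mmul_add_left mmul_sum_left)
  also have "mmul (taboo p S n) p x y = taboo p S (Suc n) x y + mmul (?t n) p x y"
    by (subst split) (simp only: mmul_add_left taboo_Suc2)
  also have "(\<Sum>k<n. mmul (mmul (?t k) (mpow p (n - k))) p x y)
      = (\<Sum>k<n. mmul (?t k) (mpow p (Suc n - k)) x y)"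
    by (intro sum.cong refl) (simp only: mmul_assoc mpow_Suc2[symmetric] Suc_diff_le lessThan_iff less_imp_le)
  finally show ?case
    by (simp add: ac_simps del: mpow.simps)
qed

text \<open>Every induced step lasts at least one unit of time.\<close>

lemma clock_eq_0: "n < l \<Longrightarrow> clock p S l n x y = 0"
proof (induction l arbitrary: n x y)
  case (Suc l)
  then have "clock p S l (n - Suc k) z y = 0" if "k < n" for k z
    using that by auto
  then show ?case by (simp add: mmul_def)
qed simp

text \<open>A path between points of S is cut at all its visits to S; l counts the visits after time
  0.\<close>

lemma mpow_eq_sum_clock:
  fixes p :: "'a::countable \<Rightarrow> 'a \<Rightarrow> ennreal"
  assumes "x \<in> S" "y \<in> S"
  shows "mpow p n x y = (\<Sum>l\<le>n. clock p S l n x y)"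
  using assms(1)
proof (induction n arbitrary: x rule: less_induct)
  case (less n)
  show ?case
  proof (cases n)
    case 0
    then show ?thesis by simp
  next
    case (Suc m)
    have IH: "mpow p (m - k) z y = (\<Sum>l\<le>m. clock p S l (m - k) z y)" if "z \<in> S" for k z
    proof -
      have "mpow p (m - k) z y = (\<Sum>l\<le>m - k. clock p S l (m - k) z y)"
        using less.IH[of "m - k" z] that Suc by simp
      also have "\<dots> = (\<Sum>l\<le>m. clock p S l (m - k) z y)"
        by (intro sum.mono_neutral_left) (auto simp: clock_eq_0)
      finally show ?thesis .
    qed
    let ?t = "\<lambda>k x z. taboo p S k x z * indicator S z"
    \<comment> \<open>Since y lies in S, a path that after time 0 meets S only at its end supplies
      the missing term k = m of the sum over first visits.\<close>
    have "taboo p S m x y = mmul (?t m) (mpow p 0) x y"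
      using \<open>y \<in> S\<close> by (simp del: mpow.simps(1))
    then have "mpow p (Suc m) x y = mmul (?t m) (mpow p (m - m)) x y
        + (\<Sum>k<m. mmul (?t k) (mpow p (m - k)) x y)"
      by (subst mpow_first_passage[where S = S]) simp
    also have "\<dots> = (\<Sum>k\<le>m. mmul (?t k) (mpow p (m - k)) x y)"
      by (simp add: lessThan_Suc_atMost[symmetric] ac_simps del: mpow.simps)
    also have "\<dots> = (\<Sum>k\<le>m. mmul (hit p S k) (\<lambda>z y. \<Sum>l\<le>m. clock p S l (m - k) z y) x y)"
    proof (intro sum.cong refl)
      fix k
      show "mmul (?t k) (mpow p (m - k)) x y
          = mmul (hit p S k) (\<lambda>z y. \<Sum>l\<le>m. clock p S l (m - k) z y) x y"
        unfolding mmul_def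
        using \<open>x \<in> S\<close> by (intro nn_integral_cong) (auto simp: hit_def IH split: split_indicator)
    qed
    also have "\<dots> = (\<Sum>l\<le>m. \<Sum>k\<le>m. mmul (hit p S k) (clock p S l (m - k)) x y)"
      by (simp only: mmul_sum_right) (rule sum.swap)
    also have "\<dots> = (\<Sum>l\<le>m. clock p S (Suc l) n x y)"
      using Suc by (simp add: lessThan_Suc_atMost)
    also have "\<dots> = (\<Sum>l\<le>n. clock p S l n x y)"
      unfolding Suc sum.atMost_Suc_shift by simp
    finally show ?thesis using Suc by simp
  qed
qed

text \<open>Summing out the total duration turns convolutions in time into matrix products.\<close>

lemma nsum_clock:
  fixes p :: "'a::countable \<Rightarrow> 'a \<Rightarrow> ennreal"
  shows "nsum (\<lambda>n. clock p S l n x y) = mpow (induced p S) l x y"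
proof (induction l arbitrary: x y)
  case 0
  have "nsum (\<lambda>n. clock p S 0 n x y) = nsum (\<lambda>n::nat. if n = 0 then (if x = y then 1 else 0) else 0)"
    by (intro nn_integral_cong) simp
  then show ?case by (simp only: nsum_delta mpow.simps)
next
  case (Suc l)
  have "nsum (\<lambda>n. clock p S (Suc l) n x y)
      = nsum (\<lambda>k. nsum (\<lambda>m. mmul (hit p S k) (clock p S l m) x y))"
    using nsum_convolution[of "\<lambda>k m. mmul (hit p S k) (clock p S l m) x y"] by simp
  also have "\<dots> = nsum (\<lambda>k. mmul (hit p S k) (mpow (induced p S) l) x y)"
    by (simp add: mmul_nsum_right[symmetric] Suc del: mpow.simps)
  also have "\<dots> = mpow (induced p S) (Suc l) x y"
    by (simp add: mmul_nsum_left[symmetric] induced_def[symmetric])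
  finally show ?case .
qed

text \<open>Subadditivity of the positive part,
  \<open>(a + b - (l + 1) K)^+ <= (a - K)^+ + (b - l K)^+\<close>, with a the duration of the first
  induced step and b that of the remaining l steps.\<close>

lemma nsum_excess_clock_le:
  fixes p :: "'a::countable \<Rightarrow> 'a \<Rightarrow> ennreal"
  shows "nsum (\<lambda>n. of_nat (n - l * K) * clock p S l n x y) \<le> excess_sum p S K l x y"
proof (induction l arbitrary: x y)
  case 0
  have "nsum (\<lambda>n. of_nat (n - 0 * K) * clock p S 0 n x y) = nsum (\<lambda>n::nat. 0)"
    by (intro nn_integral_cong) simp
  then show ?case by simp
next
  case (Suc l)
  let ?h = "hit p S" and ?c = "clock p S l"
  have "nsum (\<lambda>n. of_nat (n - Suc l * K) * clock p S (Suc l) n x y)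
      = nsum (\<lambda>n. \<Sum>k<n. of_nat (Suc k + (n - Suc k) - Suc l * K) * mmul (?h k) (?c (n - Suc k)) x y)"
    by (intro nn_integral_cong) (auto simp: sum_distrib_left intro!: sum.cong)
  also have "\<dots> = nsum (\<lambda>k. nsum (\<lambda>m. of_nat (Suc k + m - Suc l * K) * mmul (?h k) (?c m) x y))"
    by (rule nsum_convolution)
  also have "\<dots> \<le> nsum (\<lambda>k. nsum (\<lambda>m. of_nat (Suc k - K) * mmul (?h k) (?c m) x y
      + of_nat (m - l * K) * mmul (?h k) (?c m) x y))"
  proof (intro nsum_mono)
    fix k m
    have "(of_nat (Suc k + m - Suc l * K) :: ennreal) \<le> of_nat (Suc k - K + (m - l * K))"
      by (intro of_nat_mono) (simp add: add_mult_distrib)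
    then show "of_nat (Suc k + m - Suc l * K) * mmul (?h k) (?c m) x y
        \<le> of_nat (Suc k - K) * mmul (?h k) (?c m) x y + of_nat (m - l * K) * mmul (?h k) (?c m) x y"
      unfolding distrib_right[symmetric] of_nat_add by (rule mult_right_mono) simp
  qed
  also have "\<dots> = nsum (\<lambda>k. nsum (\<lambda>m. of_nat (Suc k - K) * mmul (?h k) (?c m) x y))
      + nsum (\<lambda>k. nsum (\<lambda>m. of_nat (m - l * K) * mmul (?h k) (?c m) x y))"
    by (simp add: nsum_add)
  also have "nsum (\<lambda>k. nsum (\<lambda>m. of_nat (Suc k - K) * mmul (?h k) (?c m) x y))
      = nsum (\<lambda>k. mmul (\<lambda>x z. of_nat (Suc k - K) * ?h k x z) (mpow (induced p S) l) x y)"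
  proof (intro nn_integral_cong)
    fix k
    have "nsum (\<lambda>m. of_nat (Suc k - K) * mmul (?h k) (?c m) x y)
        = of_nat (Suc k - K) * mmul (?h k) (\<lambda>x y. nsum (\<lambda>m. ?c m x y)) x y"
      by (simp add: nsum_cmult mmul_nsum_right)
    also have "\<dots> = of_nat (Suc k - K) * mmul (?h k) (mpow (induced p S) l) x y"
      by (simp add: nsum_clock)
    also have "\<dots> = mmul (\<lambda>x z. of_nat (Suc k - K) * ?h k x z) (mpow (induced p S) l) x y"
      by (simp add: mmul_def nsum_cmult[symmetric] mult.assoc)
    finally show "nsum (\<lambda>m. of_nat (Suc k - K) * mmul (?h k) (?c m) x y)
        = mmul (\<lambda>x z. of_nat (Suc k - K) * ?h k x z) (mpow (induced p S) l) x y" .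
  qed
  also have "\<dots> = mmul (excess p S K) (mpow (induced p S) l) x y"
    by (simp add: mmul_nsum_left[symmetric] excess_def[symmetric])
  also have "nsum (\<lambda>k. nsum (\<lambda>m. of_nat (m - l * K) * mmul (?h k) (?c m) x y))
      \<le> nsum (\<lambda>k. mmul (?h k) (excess_sum p S K l) x y)"
  proof (intro nsum_mono)
    fix k
    have "nsum (\<lambda>m. of_nat (m - l * K) * mmul (?h k) (?c m) x y)
        = mmul (?h k) (\<lambda>x y. nsum (\<lambda>m. of_nat (m - l * K) * ?c m x y)) x y"
      by (simp add: mmul_nsum_right) (simp add: mmul_def nsum_cmult[symmetric] mult.left_commute)
    also have "\<dots> \<le> mmul (?h k) (excess_sum p S K l) x y"
      by (intro mmul_mono Suc) simp
    finally show "nsum (\<lambda>m. of_nat (m - l * K) * mmul (?h k) (?c m) x y)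
        \<le> mmul (?h k) (excess_sum p S K l) x y" .
  qed
  also have "\<dots> = mmul (induced p S) (excess_sum p S K l) x y"
    by (simp add: mmul_nsum_left[symmetric] induced_def[symmetric])
  finally show ?case by (simp add: add_left_mono)
qed

text \<open>In summand j the step that contributes its excess comes after j ordinary induced steps
  and before l - 1 - j further ones.\<close>

lemma excess_sum_eq:
  fixes p :: "'a::countable \<Rightarrow> 'a \<Rightarrow> ennreal"
  shows "excess_sum p S K l x y = (\<Sum>j<l. mmul (mpow (induced p S) j)
    (mmul (excess p S K) (mpow (induced p S) (l - Suc j))) x y)"
proof (induction l arbitrary: x y)
  case (Suc l)
  let ?T = "induced p S" and ?E = "excess p S K"
  have "mmul ?T (excess_sum p S K l) x y
      = mmul ?T (\<lambda>x y. \<Sum>j<l. mmul (mpow ?T j) (mmul ?E (mpow ?T (l - Suc j))) x y) x y"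
    by (intro arg_cong[where f = "\<lambda>B. mmul ?T B x y"] ext Suc)
  also have "\<dots> = (\<Sum>j<l. mmul (mpow ?T (Suc j)) (mmul ?E (mpow ?T (Suc l - Suc (Suc j)))) x y)"
    by (simp add: mmul_sum_right mmul_assoc)
  finally show ?case
    by (subst sum.lessThan_Suc_shift) (simp del: mpow.simps(1))
qed simp

text \<open>Of the j steps before the long one and the l - 1 - j steps after it, one group has at
  least (l - 1) / 2 members. Time reversal at x allows this group to come last, where M bounds the
  return to x; what is left is the mean excess seen at the end of the other group.\<close>

lemma excess_sum_le:
  fixes p :: "'a::countable \<Rightarrow> 'a \<Rightarrow> ennreal"
  assumes rev: "reversible w p" and w: "w x \<noteq> 0" "w x \<noteq> \<top>"
    and M: "\<And>b y. b < l \<Longrightarrow> l \<le> Suc (2 * b) \<Longrightarrow> y \<in> S \<Longrightarrow> mpow (induced p S) b y x \<le> M"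
  shows "excess_sum p S K l x x
    \<le> 2 * M * (\<Sum>j<l. nsum (\<lambda>y. mpow (induced p S) j x y * nsum (excess p S K y)))"
proof -
  let ?T = "mpow (induced p S)" and ?E = "excess p S K"
  define a where "a j = nsum (\<lambda>y. ?T j x y * nsum (?E y))" for j
  define t where "t i j = mmul (?T i) (mmul ?E (?T j)) x x" for i j
  \<comment> \<open>Reversing a closed path at x exchanges the numbers of induced steps before and
    after the long one. The factor \<open>w x\<close> can be cancelled because it is neither 0 nor
    infinite.\<close>
  have sym: "t i j = t j i" for i j
  proof -
    have "w x * mmul (mmul (?T i) ?E) (?T j) x x = w x * t j i" unfolding t_def
    proof -
      have mm: "w z * mmul (?T i) ?E z y = w y * mmul ?E (?T i) y z" for z y
        by (intro reversible_mmul reversible_mpow reversible_induced reversible_excess rev)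
      have tt: "w z * ?T j z y = w y * ?T j y z" for z y
        using reversible_mpow[OF reversible_induced[OF rev], of S j] by (simp add: reversible_def)
      have "w x * (mmul (?T i) ?E x z * ?T j z x) = w x * (?T j x z * mmul ?E (?T i) z x)" for z
      proof -
        fix z
        have "w x * (mmul (?T i) ?E x z * ?T j z x) = (w x * mmul (?T i) ?E x z) * ?T j z x"
          by (simp only: mult.assoc)
        also have "\<dots> = (w z * ?T j z x) * mmul ?E (?T i) z x"
          by (simp only: mm ac_simps)
        also have "\<dots> = w x * (?T j x z * mmul ?E (?T i) z x)"
          by (simp only: tt ac_simps)
        finally show "w x * (mmul (?T i) ?E x z * ?T j z x) = w x * (?T j x z * mmul ?E (?T i) z x)" .
      qed
      then show "w x * mmul (mmul (?T i) ?E) (?T j) x x = w x * mmul (?T j) (mmul ?E (?T i)) x x"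
        by (simp add: mmul_def[of "mmul _ _"] mmul_def[of "?T j"] nsum_cmult[symmetric])
    qed
    then show ?thesis
      using w by (simp add: t_def mmul_assoc ennreal_mult_cancel_left)
  qed
  \<comment> \<open>The matrix \<open>excess\<close> charges only endpoints in S, which is where M
    is available.\<close>
  have bound: "t i j \<le> M * a i" if "j < l" "l \<le> Suc (2 * j)" for i j
  proof -
    have "mmul ?E (?T j) y x \<le> M * nsum (?E y)" for y
    proof -
      have "?E y z * ?T j z x \<le> M * ?E y z" for z
      proof (cases "z \<in> S")
        case True
        with M[OF that] show ?thesis by (metis mult.commute mult_right_mono zero_le)
      next
        case False
        then have "?E y z = 0" by (simp add: excess_def hit_def)
        then show ?thesis by simp
      qed
      then show ?thesis
        unfolding mmul_def nsum_cmult[symmetric] by (intro nsum_mono)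
    qed
    then have "t i j \<le> nsum (\<lambda>y. ?T i x y * (M * nsum (?E y)))"
      unfolding t_def mmul_def[of "?T i"] by (intro nsum_mono mult_left_mono) auto
    then show ?thesis
      by (simp add: a_def nsum_cmult[symmetric] ac_simps)
  qed
  \<comment> \<open>Adding the bounds of both cases avoids recording which half is long; after the
    reflection of j to l - 1 - j this costs the factor 2.\<close>
  have "t j (l - Suc j) \<le> M * (a j + a (l - Suc j))" if "j < l" for j
  proof (cases "l \<le> Suc (2 * (l - Suc j))")
    case True
    then have "t j (l - Suc j) \<le> M * a j"
      using that by (intro bound) auto
    then show ?thesis by (simp add: distrib_left add_increasing2)
  next
    case False
    then have "t (l - Suc j) j \<le> M * a (l - Suc j)"
      using that by (intro bound) auto
    then show ?thesis by (simp add: distrib_left add_increasing sym)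
  qed
  then have "excess_sum p S K l x x \<le> (\<Sum>j<l. M * (a j + a (l - Suc j)))"
    unfolding excess_sum_eq t_def[symmetric] by (intro sum_mono) auto
  also have "\<dots> = M * ((\<Sum>j<l. a j) + (\<Sum>j<l. a (l - Suc j)))"
    by (simp add: sum_distrib_left[symmetric] sum.distrib)
  also have "(\<Sum>j<l. a (l - Suc j)) = (\<Sum>j<l. a j)"
    by (rule sum.nat_diff_reindex)
  finally show ?thesis
    by (simp add: a_def mult_2 mult_2_right distrib_left distrib_right ac_simps)
qed

section \<open>Law and mean of the first hitting time\<close>

lemma nsum_le_of_sum_le:
  fixes f :: "nat \<Rightarrow> ennreal"
  assumes "\<And>n. (\<Sum>k<n. f k) \<le> c"
  shows "nsum f \<le> c"
  unfolding nn_integral_count_space_nat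
  by (rule suminf_le_const[OF summableI assms])

lemma sum_le_nsum:
  fixes f :: "nat \<Rightarrow> ennreal"
  assumes "finite I"
  shows "(\<Sum>k\<in>I. f k) \<le> nsum f"
  unfolding nn_integral_count_space_nat
  by (rule sum_le_suminf[OF summableI assms]) simp

text \<open>With T the first positive time in S, this is the tail P(T > n + 1) from x, and
  \<open>enter_prob\<close> is P(T = n + 1). The start x may lie on either side of S, and Kac's
  formula uses both.\<close>

definition leave_prob :: "('a \<Rightarrow> 'a \<Rightarrow> ennreal) \<Rightarrow> 'a set \<Rightarrow> nat \<Rightarrow> 'a \<Rightarrow> ennreal" where
  "leave_prob p S n x = nsum (\<lambda>y. taboo p S n x y * indicator (- S) y)"

definition enter_prob :: "('a \<Rightarrow> 'a \<Rightarrow> ennreal) \<Rightarrow> 'a set \<Rightarrow> nat \<Rightarrow> 'a \<Rightarrow> ennreal" where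
  "enter_prob p S n x = nsum (\<lambda>y. taboo p S n x y * indicator S y)"

context
  fixes p :: "'a::countable \<Rightarrow> 'a \<Rightarrow> ennreal"
  assumes row: "\<And>x. nsum (p x) = 1"
begin

lemma enter_leave_0: "enter_prob p S 0 x + leave_prob p S 0 x = 1"
proof -
  have "enter_prob p S 0 x + leave_prob p S 0 x = nsum (p x)"
    unfolding enter_prob_def leave_prob_def nsum_add[symmetric] taboo_0
    by (intro nn_integral_cong) (auto split: split_indicator)
  then show ?thesis by (simp add: row)
qed

lemma enter_leave_Suc: "enter_prob p S (Suc n) x + leave_prob p S (Suc n) x = leave_prob p S n x"
proof -
  have "enter_prob p S (Suc n) x + leave_prob p S (Suc n) x = nsum (taboo p S (Suc n) x)"
    unfolding enter_prob_def leave_prob_def nsum_add[symmetric]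
    by (intro nn_integral_cong) (auto split: split_indicator)
  then show ?thesis
    by (simp add: taboo_Suc2 mmul_row_sum row leave_prob_def)
qed

lemma sum_enter_prob: "(\<Sum>k\<le>n. enter_prob p S k x) + leave_prob p S n x = 1"
proof (induction n)
  case 0
  then show ?case by (simp add: enter_leave_0)
next
  case (Suc n)
  then show ?case by (simp add: add.assoc enter_leave_Suc)
qed

lemma nsum_enter_prob_le: "nsum (\<lambda>k. enter_prob p S k x) \<le> 1"
proof (rule nsum_le_of_sum_le)
  fix n
  have "(\<Sum>k<n. enter_prob p S k x) \<le> (\<Sum>k\<le>n. enter_prob p S k x)"
    by (intro sum_mono2) auto
  also have "\<dots> \<le> (\<Sum>k\<le>n. enter_prob p S k x) + leave_prob p S n x" by simp
  finally show "(\<Sum>k<n. enter_prob p S k x) \<le> 1" by (simp add: sum_enter_prob)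
qed

text \<open>Summation by parts: both sides are the mean of min(T, n + 1). The boundary term stays on
  the left, so that no subtraction occurs.\<close>

lemma sum_Suc_enter_prob:
  "(\<Sum>k\<le>n. of_nat (Suc k) * enter_prob p S k x) + of_nat (Suc n) * leave_prob p S n x
    = 1 + (\<Sum>k<n. leave_prob p S k x)"
proof (induction n)
  case 0
  then show ?case by (simp add: enter_leave_0)
next
  case (Suc n)
  have "(\<Sum>k\<le>Suc n. of_nat (Suc k) * enter_prob p S k x)
      + of_nat (Suc (Suc n)) * leave_prob p S (Suc n) x
    = (\<Sum>k\<le>n. of_nat (Suc k) * enter_prob p S k x)
      + of_nat (Suc (Suc n)) * (enter_prob p S (Suc n) x + leave_prob p S (Suc n) x)"
    by (simp only: sum.atMost_Suc distrib_left add.assoc)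
  also have "\<dots> = ((\<Sum>k\<le>n. of_nat (Suc k) * enter_prob p S k x)
      + of_nat (Suc n) * leave_prob p S n x) + leave_prob p S n x"
    by (simp only: enter_leave_Suc of_nat_Suc[of "Suc n"] distrib_right mult_1 ac_simps)
  finally show ?case by (simp only: Suc sum.lessThan_Suc add.assoc)
qed

text \<open>Only an inequality, because the left side does not count paths that never hit S.\<close>

lemma nsum_Suc_enter_prob_le:
  "nsum (\<lambda>k. of_nat (Suc k) * enter_prob p S k x) \<le> 1 + nsum (\<lambda>k. leave_prob p S k x)"
proof (rule nsum_le_of_sum_le)
  fix n
  have "(\<Sum>k<n. of_nat (Suc k) * enter_prob p S k x)
      \<le> (\<Sum>k\<le>n. of_nat (Suc k) * enter_prob p S k x)"
    by (intro sum_mono2) auto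
  also have "\<dots> \<le> 1 + (\<Sum>k<n. leave_prob p S k x)"
    unfolding sum_Suc_enter_prob[symmetric] by simp
  also have "\<dots> \<le> 1 + nsum (\<lambda>k. leave_prob p S k x)"
    by (intro add_left_mono sum_le_nsum) simp
  finally show "(\<Sum>k<n. of_nat (Suc k) * enter_prob p S k x) \<le> 1 + nsum (\<lambda>k. leave_prob p S k x)" .
qed

lemma nsum_hit: "nsum (hit p S k x) = indicator S x * enter_prob p S k x"
  by (simp add: hit_def enter_prob_def nsum_cmult)

lemma nsum_excess: "nsum (excess p S K x)
    = indicator S x * nsum (\<lambda>k. of_nat (Suc k - K) * enter_prob p S k x)"
proof -
  have "nsum (excess p S K x) = nsum (\<lambda>k. nsum (\<lambda>y. of_nat (Suc k - K) * hit p S k x y))"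
    unfolding excess_def by (rule nsum_swap)
  then show ?thesis by (simp only: nsum_cmult nsum_hit mult.left_commute)
qed

text \<open>Only a bound: rows outside S vanish, and a return to S need not be certain.\<close>

lemma induced_row_sum_le: "nsum (induced p S x) \<le> 1"
proof -
  have "nsum (induced p S x) = nsum (\<lambda>k. nsum (hit p S k x))"
    unfolding induced_def by (rule nsum_swap)
  also have "\<dots> = indicator S x * nsum (\<lambda>k. enter_prob p S k x)"
    by (simp only: nsum_hit nsum_cmult)
  also have "\<dots> \<le> 1 * 1"
    by (intro mult_mono nsum_enter_prob_le) (auto split: split_indicator)
  finally show ?thesis by simp
qed

section \<open>Monotonicity of even return probabilities\<close>

lemma two_mult_le_squares: "2 * (a * b) \<le> a\<^sup>2 + b\<^sup>2" for a b :: ennreal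
proof -
  have *: "2 * (a * b) \<le> a\<^sup>2 + b\<^sup>2" if "a \<le> b" for a b :: ennreal
  proof -
    from that obtain c where c: "b = a + c" by (auto simp: le_iff_add)
    have "a\<^sup>2 + b\<^sup>2 = 2 * (a * b) + c\<^sup>2"
      unfolding c by (simp only: power2_eq_square mult_2 mult_2_right distrib_left distrib_right ac_simps)
    then show ?thesis by simp
  qed
  show ?thesis
    using *[of a b] *[of b a] by (cases a b rule: linorder_cases) (auto simp: ac_simps)
qed

text \<open>Twice the square is a double sum over z and u; there \<open>2ab <= a^2 + b^2\<close>
  applies, and the row sums equal to 1 remove one of the two variables.\<close>

lemma jensen_square: "(nsum (\<lambda>z. p x z * f z))\<^sup>2 \<le> nsum (\<lambda>z. p x z * (f z)\<^sup>2)"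
proof -
  let ?I = "nsum (\<lambda>z. p x z * (f z)\<^sup>2)"
  have "2 * (nsum (\<lambda>z. p x z * f z))\<^sup>2
      = nsum (\<lambda>z. nsum (\<lambda>u. p x z * p x u * (2 * (f z * f u))))"
  proof -
    have "nsum (\<lambda>u. p x z * p x u * (2 * (f z * f u))) = 2 * ((p x z * f z) * nsum (\<lambda>u. p x u * f u))" for z
      unfolding nsum_cmult[symmetric] by (simp add: ac_simps)
    then show ?thesis by (simp add: nsum_cmult nsum_multc power2_eq_square)
  qed
  also have "\<dots> \<le> nsum (\<lambda>z. nsum (\<lambda>u. p x z * p x u * ((f z)\<^sup>2 + (f u)\<^sup>2)))"
    by (intro nsum_mono mult_left_mono two_mult_le_squares) simp
  also have "\<dots> = nsum (\<lambda>z. nsum (\<lambda>u. (p x z * (f z)\<^sup>2) * p x u + p x z * (p x u * (f u)\<^sup>2)))"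
    by (simp add: distrib_left ac_simps)
  also have "\<dots> = 2 * ?I"
    by (simp only: nsum_add nsum_cmult row nsum_multc mult_1 mult_1_right mult_2)
  finally show ?thesis
    by (subst (asm) ennreal_mult_le_mult_iff) auto
qed

text \<open>By reversibility \<open>w x * mpow p (2 * n) x x\<close> is the squared norm of
  \<open>mpow p n _ x\<close> in the L2 space weighted by w, and p is a contraction there by Jensen
  and the invariance of w.\<close>

lemma mpow_even_decreasing:
  assumes rev: "reversible w p" and w: "w x \<noteq> 0" "w x \<noteq> \<top>"
  shows "mpow p (2 * Suc n) x x \<le> mpow p (2 * n) x x"
proof -
  have sq: "w x * mpow p (2 * n) x x = nsum (\<lambda>y. w y * (mpow p n y x)\<^sup>2)" for n
  proof -
    have "w x * mpow p (2 * n) x x = nsum (\<lambda>y. (w x * mpow p n x y) * mpow p n y x)"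
      by (simp only: mult_2 mpow_add mmul_def nsum_cmult mult.assoc)
    also have "\<dots> = nsum (\<lambda>y. (w y * mpow p n y x) * mpow p n y x)"
      using reversible_mpow[OF rev, of n] by (simp only: reversible_def)
    finally show ?thesis by (simp only: power2_eq_square mult.assoc)
  qed
  have "w x * mpow p (2 * Suc n) x x = nsum (\<lambda>y. w y * (nsum (\<lambda>z. p y z * mpow p n z x))\<^sup>2)"
    by (simp only: sq mpow.simps(2) mmul_def)
  also have "\<dots> \<le> nsum (\<lambda>y. w y * nsum (\<lambda>z. p y z * (mpow p n z x)\<^sup>2))"
    by (intro nsum_mono mult_left_mono jensen_square) simp
  also have "\<dots> = nsum (\<lambda>y. nsum (\<lambda>z. w z * p z y * (mpow p n z x)\<^sup>2))"
    using rev by (simp only: nsum_cmult[symmetric] mult.assoc[symmetric] reversible_def)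
  also have "\<dots> = nsum (\<lambda>z. nsum (\<lambda>y. w z * p z y * (mpow p n z x)\<^sup>2))"
    by (rule nsum_swap)
  also have "\<dots> = nsum (\<lambda>z. w z * (mpow p n z x)\<^sup>2)"
    by (simp add: nsum_multc nsum_cmult row)
  also have "\<dots> = w x * mpow p (2 * n) x x"
    by (simp only: sq)
  finally show ?thesis
    using w by (subst (asm) ennreal_mult_le_mult_iff) auto
qed

end

section \<open>Walks in a stationary environment\<close>

lemma borel_measurable_nsum [measurable (raw)]:
  fixes f :: "'w \<Rightarrow> 'a::countable \<Rightarrow> ennreal"
  assumes "\<And>y. (\<lambda>\<omega>. f \<omega> y) \<in> borel_measurable M"
  shows "(\<lambda>\<omega>. nsum (f \<omega>)) \<in> borel_measurable M"
proof -
  interpret sigma_finite_measure "count_space (UNIV :: 'a set)"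
    by (rule sigma_finite_measure_count_space)
  have "(\<lambda>(y, \<omega>). f \<omega> y) \<in> borel_measurable (count_space UNIV \<Otimes>\<^sub>M M)"
    using assms by (intro measurable_pair_measure_countable1) auto
  then have "(\<lambda>(\<omega>, y). f \<omega> y) \<in> borel_measurable (M \<Otimes>\<^sub>M count_space UNIV)"
    by (subst (asm) measurable_pair_swap_iff) (simp add: case_prod_beta')
  then show ?thesis
    by (rule borel_measurable_nn_integral)
qed

lemma nsum_translate:
  fixes f :: "'g::ab_group_add \<Rightarrow> ennreal"
  shows "nsum (\<lambda>u. f (u + z)) = nsum f"
  by (rule nn_integral_bij_count_space) (rule bij_betwI[where g = "\<lambda>u. u - z"], auto)

lemma nsum_uminus:
  fixes f :: "'g::ab_group_add \<Rightarrow> ennreal"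
  shows "nsum (\<lambda>u. f (- u)) = nsum f"
  by (rule nn_integral_bij_count_space) (rule bij_betwI[where g = uminus], auto)

text \<open>A measure-preserving action of a countable abelian group on environments. The covariance
  conditions say that kernel, weight and set seen from z in \<omega> are those seen from 0 in the
  shifted environment.\<close>

locale stationary_walk =
  fixes M :: "'w measure" and \<tau> :: "'g::{countable, ab_group_add} \<Rightarrow> 'w \<Rightarrow> 'w"
    and p :: "'w \<Rightarrow> 'g \<Rightarrow> 'g \<Rightarrow> ennreal" and w :: "'w \<Rightarrow> 'g \<Rightarrow> ennreal" and S :: "'w \<Rightarrow> 'g set"
  assumes shift_meas [measurable]: "\<And>z. \<tau> z \<in> measurable M M"
    and shift_distr: "\<And>z. distr M M (\<tau> z) = M"
    and p_meas [measurable]: "\<And>x y. (\<lambda>\<omega>. p \<omega> x y) \<in> borel_measurable M"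
    and w_meas [measurable]: "\<And>x. (\<lambda>\<omega>. w \<omega> x) \<in> borel_measurable M"
    and S_meas [measurable]: "\<And>x. Measurable.pred M (\<lambda>\<omega>. x \<in> S \<omega>)"
    and p_shift: "\<And>\<omega> x y z. \<omega> \<in> space M \<Longrightarrow> p (\<tau> z \<omega>) x y = p \<omega> (x + z) (y + z)"
    and w_shift: "\<And>\<omega> x z. \<omega> \<in> space M \<Longrightarrow> w (\<tau> z \<omega>) x = w \<omega> (x + z)"
    and S_shift: "\<And>\<omega> x z. \<omega> \<in> space M \<Longrightarrow> x \<in> S (\<tau> z \<omega>) \<longleftrightarrow> x + z \<in> S \<omega>"
    and row: "\<And>\<omega> x. \<omega> \<in> space M \<Longrightarrow> nsum (p \<omega> x) = 1"
    and rev: "\<And>\<omega>. \<omega> \<in> space M \<Longrightarrow> reversible (w \<omega>) (p \<omega>)"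
begin

text \<open>Measurability and diagonal invariance are bundled because mass transport uses both, and
  products, powers and countable sums inherit both.\<close>

definition covariant :: "('w \<Rightarrow> 'g \<Rightarrow> 'g \<Rightarrow> ennreal) \<Rightarrow> bool" where
  "covariant A \<longleftrightarrow> (\<forall>x y. (\<lambda>\<omega>. A \<omega> x y) \<in> borel_measurable M) \<and>
     (\<forall>\<omega>\<in>space M. \<forall>x y z. A (\<tau> z \<omega>) x y = A \<omega> (x + z) (y + z))"

definition covariant_fun :: "('w \<Rightarrow> 'g \<Rightarrow> ennreal) \<Rightarrow> bool" where
  "covariant_fun f \<longleftrightarrow> (\<forall>x. (\<lambda>\<omega>. f \<omega> x) \<in> borel_measurable M) \<and>
     (\<forall>\<omega>\<in>space M. \<forall>x z. f (\<tau> z \<omega>) x = f \<omega> (x + z))"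

lemma covariantD:
  "covariant A \<Longrightarrow> (\<lambda>\<omega>. A \<omega> x y) \<in> borel_measurable M"
  "covariant A \<Longrightarrow> \<omega> \<in> space M \<Longrightarrow> A (\<tau> z \<omega>) x y = A \<omega> (x + z) (y + z)"
  by (auto simp: covariant_def)

lemma covariant_funD:
  "covariant_fun f \<Longrightarrow> (\<lambda>\<omega>. f \<omega> x) \<in> borel_measurable M"
  "covariant_fun f \<Longrightarrow> \<omega> \<in> space M \<Longrightarrow> f (\<tau> z \<omega>) x = f \<omega> (x + z)"
  by (auto simp: covariant_fun_def)

lemma covariant_p: "covariant p"
  by (auto simp: covariant_def p_shift)

lemma covariant_w: "covariant_fun w"
  by (auto simp: covariant_fun_def w_shift)

lemma covariant_S: "covariant_fun (\<lambda>\<omega>. indicator (S \<omega>))"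
  by (auto simp: covariant_fun_def S_shift split: split_indicator)

lemma covariant_Compl_S: "covariant_fun (\<lambda>\<omega>. indicator (- S \<omega>))"
  unfolding covariant_fun_def
proof safe
  fix x
  have "(\<lambda>\<omega>. indicator (- S \<omega>) x :: ennreal) = (\<lambda>\<omega>. if x \<in> S \<omega> then 0 else 1)"
    by auto
  then show "(\<lambda>\<omega>. indicator (- S \<omega>) x :: ennreal) \<in> borel_measurable M" by simp
qed (auto simp: S_shift split: split_indicator)

lemma covariant_mult:
  "covariant A \<Longrightarrow> covariant B \<Longrightarrow> covariant (\<lambda>\<omega> x y. A \<omega> x y * B \<omega> x y)"
  by (auto simp: covariant_def intro!: borel_measurable_times_ennreal)

lemma covariant_left: "covariant_fun f \<Longrightarrow> covariant (\<lambda>\<omega> x y. f \<omega> x)"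
  by (auto simp: covariant_def covariant_fun_def)

lemma covariant_right: "covariant_fun f \<Longrightarrow> covariant (\<lambda>\<omega> x y. f \<omega> y)"
  by (auto simp: covariant_def covariant_fun_def)

lemma covariant_mmul:
  assumes A: "covariant A" and B: "covariant B"
  shows "covariant (\<lambda>\<omega>. mmul (A \<omega>) (B \<omega>))"
  unfolding covariant_def
proof safe
  note [measurable] = covariantD(1)[OF A] covariantD(1)[OF B]
  show "(\<lambda>\<omega>. mmul (A \<omega>) (B \<omega>) x y) \<in> borel_measurable M" for x y
    unfolding mmul_def by measurable
  fix \<omega> x y z
  assume \<omega>: "\<omega> \<in> space M"
  show "mmul (A (\<tau> z \<omega>)) (B (\<tau> z \<omega>)) x y = mmul (A \<omega>) (B \<omega>) (x + z) (y + z)"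
    using nsum_translate[of "\<lambda>u. A \<omega> (x + z) u * B \<omega> u (y + z)" z]
    by (simp add: mmul_def covariantD(2)[OF A \<omega>] covariantD(2)[OF B \<omega>])
qed

lemma covariant_apply:
  assumes A: "covariant A" and f: "covariant_fun f"
  shows "covariant_fun (\<lambda>\<omega> x. nsum (\<lambda>y. A \<omega> x y * f \<omega> y))"
  unfolding covariant_fun_def
proof safe
  note [measurable] = covariantD(1)[OF A] covariant_funD(1)[OF f]
  show "(\<lambda>\<omega>. nsum (\<lambda>y. A \<omega> x y * f \<omega> y)) \<in> borel_measurable M" for x
    by measurable
  fix \<omega> x z
  assume \<omega>: "\<omega> \<in> space M"
  show "nsum (\<lambda>y. A (\<tau> z \<omega>) x y * f (\<tau> z \<omega>) y) = nsum (\<lambda>y. A \<omega> (x + z) y * f \<omega> y)"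
    using nsum_translate[of "\<lambda>u. A \<omega> (x + z) u * f \<omega> u" z]
    by (simp add: covariantD(2)[OF A \<omega>] covariant_funD(2)[OF f \<omega>])
qed

lemma covariant_mpow:
  assumes A: "covariant A"
  shows "covariant (\<lambda>\<omega>. mpow (A \<omega>) n)"
proof (induction n)
  case 0
  show ?case by (simp add: covariant_def)
next
  case (Suc n)
  show ?case using covariant_mmul[OF A Suc] by simp
qed

lemma covariant_nsum:
  fixes A :: "'i::countable \<Rightarrow> 'w \<Rightarrow> 'g \<Rightarrow> 'g \<Rightarrow> ennreal"
  assumes "\<And>i. covariant (A i)"
  shows "covariant (\<lambda>\<omega> x y. nsum (\<lambda>i. c i * A i \<omega> x y))"
  using assms by (auto simp: covariant_def intro!: borel_measurable_nsum borel_measurable_times_ennreal)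

lemma covariant_taboo: "covariant (\<lambda>\<omega>. taboo (p \<omega>) (S \<omega>) n)"
  unfolding taboo_def
  by (intro covariant_mmul covariant_mpow covariant_p)
     (use covariant_mult[OF covariant_p covariant_right[OF covariant_Compl_S]]
       in \<open>simp add: avoid_def[abs_def]\<close>)

lemma covariant_hit: "covariant (\<lambda>\<omega>. hit (p \<omega>) (S \<omega>) n)"
  unfolding hit_def[abs_def]
  by (intro covariant_mult covariant_left covariant_right covariant_S covariant_taboo)

lemma covariant_induced: "covariant (\<lambda>\<omega>. induced (p \<omega>) (S \<omega>))"
  using covariant_nsum[OF covariant_hit, of "\<lambda>_. 1"] by (simp add: induced_def[abs_def])

lemma covariant_excess: "covariant (\<lambda>\<omega>. excess (p \<omega>) (S \<omega>) K)"
  unfolding excess_def[abs_def] by (intro covariant_nsum covariant_hit)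

lemma covariant_excess_mean: "covariant_fun (\<lambda>\<omega> x. nsum (excess (p \<omega>) (S \<omega>) K x))"
  using covariant_apply[OF covariant_excess, of "\<lambda>_ _. 1" K] by (simp add: covariant_fun_def)

text \<open>By stationarity the mean mass sent from 0 to y equals the mean mass sent from -y to 0;
  sum over y.\<close>

lemma mass_transport:
  assumes G: "covariant G"
  shows "(\<integral>\<^sup>+\<omega>. nsum (\<lambda>y. G \<omega> 0 y) \<partial>M) = (\<integral>\<^sup>+\<omega>. nsum (\<lambda>y. G \<omega> y 0) \<partial>M)"
proof -
  note [measurable] = covariantD(1)[OF G]
  have "(\<integral>\<^sup>+\<omega>. G \<omega> 0 y \<partial>M) = (\<integral>\<^sup>+\<omega>. G \<omega> (- y) 0 \<partial>M)" for y
  proof -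
    have "(\<integral>\<^sup>+\<omega>. G \<omega> 0 y \<partial>M) = (\<integral>\<^sup>+\<omega>. G \<omega> 0 y \<partial>distr M M (\<tau> (- y)))"
      by (simp add: shift_distr)
    also have "\<dots> = (\<integral>\<^sup>+\<omega>. G (\<tau> (- y) \<omega>) 0 y \<partial>M)"
      by (rule nn_integral_distr) measurable
    also have "\<dots> = (\<integral>\<^sup>+\<omega>. G \<omega> (- y) 0 \<partial>M)"
      by (intro nn_integral_cong) (simp add: covariantD(2)[OF G])
    finally show ?thesis .
  qed
  then have "(\<integral>\<^sup>+\<omega>. nsum (\<lambda>y. G \<omega> 0 y) \<partial>M) = nsum (\<lambda>y. \<integral>\<^sup>+\<omega>. G \<omega> (- y) 0 \<partial>M)"
    by (simp add: nn_integral_count_space_nn_integral)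
  also have "\<dots> = nsum (\<lambda>y. \<integral>\<^sup>+\<omega>. G \<omega> y 0 \<partial>M)"
    by (rule nsum_uminus)
  also have "\<dots> = (\<integral>\<^sup>+\<omega>. nsum (\<lambda>y. G \<omega> y 0) \<partial>M)"
    by (rule nn_integral_count_space_nn_integral[symmetric]) simp_all
  finally show ?thesis .
qed

text \<open>Self-adjointness of A for the measure with density \<open>w \<omega> 0\<close>: mass
  transport exchanges the endpoints, and detailed balance turns A back.\<close>

lemma mass_transport_reversible:
  assumes A: "covariant A" "\<And>\<omega>. \<omega> \<in> space M \<Longrightarrow> reversible (w \<omega>) (A \<omega>)"
    and f: "covariant_fun f" and g: "covariant_fun g"
  shows "(\<integral>\<^sup>+\<omega>. w \<omega> 0 * g \<omega> 0 * nsum (\<lambda>y. A \<omega> 0 y * f \<omega> y) \<partial>M)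
    = (\<integral>\<^sup>+\<omega>. w \<omega> 0 * f \<omega> 0 * nsum (\<lambda>y. A \<omega> 0 y * g \<omega> y) \<partial>M)"
proof -
  let ?G = "\<lambda>\<omega> x y. w \<omega> x * g \<omega> x * (A \<omega> x y * f \<omega> y)"
  have G: "covariant ?G"
    by (intro covariant_mult covariant_left covariant_right covariant_w f g A)
  have "(\<integral>\<^sup>+\<omega>. w \<omega> 0 * g \<omega> 0 * nsum (\<lambda>y. A \<omega> 0 y * f \<omega> y) \<partial>M) = (\<integral>\<^sup>+\<omega>. nsum (\<lambda>y. ?G \<omega> 0 y) \<partial>M)"
    by (simp only: nsum_cmult)
  also have "\<dots> = (\<integral>\<^sup>+\<omega>. nsum (\<lambda>y. ?G \<omega> y 0) \<partial>M)"
    by (rule mass_transport[OF G])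
  also have "\<dots> = (\<integral>\<^sup>+\<omega>. w \<omega> 0 * f \<omega> 0 * nsum (\<lambda>y. A \<omega> 0 y * g \<omega> y) \<partial>M)"
  proof (intro nn_integral_cong)
    fix \<omega> assume \<omega>: "\<omega> \<in> space M"
    have "?G \<omega> y 0 = w \<omega> 0 * f \<omega> 0 * (A \<omega> 0 y * g \<omega> y)" for y
    proof -
      have "?G \<omega> y 0 = (w \<omega> y * A \<omega> y 0) * g \<omega> y * f \<omega> 0" by (simp only: ac_simps)
      also have "w \<omega> y * A \<omega> y 0 = w \<omega> 0 * A \<omega> 0 y" using A(2)[OF \<omega>] by (simp add: reversible_def)
      finally show ?thesis by (simp only: ac_simps)
    qed
    then show "nsum (\<lambda>y. ?G \<omega> y 0) = w \<omega> 0 * f \<omega> 0 * nsum (\<lambda>y. A \<omega> 0 y * g \<omega> y)"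
      by (simp only: nsum_cmult)
  qed
  finally show ?thesis .
qed

text \<open>The mean of \<open>T_1\<close> from S is at most one plus the sum of its tails. Reversed
  in time, the tail event \<open>T_1 > k + 1\<close> from S becomes a first hit of S at time k + 1
  from outside. Over k these events are disjoint, so their total weight is at most that of the
  complement of S. At K = 0 the excess is all of \<open>T_1\<close>.\<close>

lemma kac:
  "(\<integral>\<^sup>+\<omega>. w \<omega> 0 * nsum (excess (p \<omega>) (S \<omega>) 0 0) \<partial>M) \<le> (\<integral>\<^sup>+\<omega>. w \<omega> 0 \<partial>M)"
proof -
  let ?in = "\<lambda>\<omega> x. indicator (S \<omega>) x :: ennreal"
  let ?out = "\<lambda>\<omega> x. indicator (- S \<omega>) x :: ennreal"
  let ?leave = "\<lambda>\<omega> k x. leave_prob (p \<omega>) (S \<omega>) k x"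
  let ?enter = "\<lambda>\<omega> k x. enter_prob (p \<omega>) (S \<omega>) k x"
  note [measurable] = covariant_funD(1)[OF covariant_S] covariant_funD(1)[OF covariant_Compl_S]
    covariantD(1)[OF covariant_taboo]
  have [measurable]: "(\<lambda>\<omega>. ?leave \<omega> k x) \<in> borel_measurable M"
    "(\<lambda>\<omega>. ?enter \<omega> k x) \<in> borel_measurable M" for k x
    unfolding leave_prob_def enter_prob_def by measurable
  have "(\<integral>\<^sup>+\<omega>. w \<omega> 0 * nsum (excess (p \<omega>) (S \<omega>) 0 0) \<partial>M)
      \<le> (\<integral>\<^sup>+\<omega>. w \<omega> 0 * (?in \<omega> 0 * (1 + nsum (\<lambda>k. ?leave \<omega> k 0))) \<partial>M)"
  proof (intro nn_integral_mono mult_left_mono)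
    fix \<omega> assume \<omega>: "\<omega> \<in> space M"
    have "nsum (excess (p \<omega>) (S \<omega>) 0 0) = ?in \<omega> 0 * nsum (\<lambda>k. of_nat (Suc k) * ?enter \<omega> k 0)"
      by (subst nsum_excess[OF row[OF \<omega>]]) simp
    also have "\<dots> \<le> ?in \<omega> 0 * (1 + nsum (\<lambda>k. ?leave \<omega> k 0))"
      by (intro mult_left_mono nsum_Suc_enter_prob_le row \<omega>) simp
    finally show "nsum (excess (p \<omega>) (S \<omega>) 0 0) \<le> ?in \<omega> 0 * (1 + nsum (\<lambda>k. ?leave \<omega> k 0))" .
  qed simp
  also have "\<dots> = (\<integral>\<^sup>+\<omega>. w \<omega> 0 * ?in \<omega> 0 + nsum (\<lambda>k. w \<omega> 0 * ?in \<omega> 0 * ?leave \<omega> k 0) \<partial>M)"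
    by (simp only: nsum_cmult distrib_left mult.assoc mult_1_right)
  also have "\<dots> = (\<integral>\<^sup>+\<omega>. w \<omega> 0 * ?in \<omega> 0 \<partial>M) + nsum (\<lambda>k. \<integral>\<^sup>+\<omega>. w \<omega> 0 * ?in \<omega> 0 * ?leave \<omega> k 0 \<partial>M)"
    by (simp add: nn_integral_add nn_integral_count_space_nn_integral)
  \<comment> \<open>Self-adjointness of \<open>taboo\<close>, tested with the indicators of S and of
    its complement.\<close>
  also have "(\<lambda>k. \<integral>\<^sup>+\<omega>. w \<omega> 0 * ?in \<omega> 0 * ?leave \<omega> k 0 \<partial>M)
      = (\<lambda>k. \<integral>\<^sup>+\<omega>. w \<omega> 0 * ?out \<omega> 0 * ?enter \<omega> k 0 \<partial>M)"
    unfolding leave_prob_def enter_prob_def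
    by (intro ext mass_transport_reversible covariant_taboo reversible_taboo rev
        covariant_S covariant_Compl_S)
  also have "nsum (\<lambda>k. \<integral>\<^sup>+\<omega>. w \<omega> 0 * ?out \<omega> 0 * ?enter \<omega> k 0 \<partial>M)
      = (\<integral>\<^sup>+\<omega>. w \<omega> 0 * ?out \<omega> 0 * nsum (\<lambda>k. ?enter \<omega> k 0) \<partial>M)"
    by (simp add: nn_integral_count_space_nn_integral[symmetric] nsum_cmult)
  also have "\<dots> \<le> (\<integral>\<^sup>+\<omega>. w \<omega> 0 * ?out \<omega> 0 * 1 \<partial>M)"
    by (intro nn_integral_mono mult_left_mono nsum_enter_prob_le row) simp_all
  also have "(\<integral>\<^sup>+\<omega>. w \<omega> 0 * ?in \<omega> 0 \<partial>M) + (\<integral>\<^sup>+\<omega>. w \<omega> 0 * ?out \<omega> 0 * 1 \<partial>M)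
      = (\<integral>\<^sup>+\<omega>. w \<omega> 0 \<partial>M)"
    by (subst nn_integral_add[symmetric]) (auto intro!: nn_integral_cong split: split_indicator)
  finally show ?thesis by (simp add: add_left_mono)
qed

end

section \<open>The maximal inequality\<close>

definition birkhoff :: "('a \<Rightarrow> 'a \<Rightarrow> ennreal) \<Rightarrow> ('a \<Rightarrow> ennreal) \<Rightarrow> nat \<Rightarrow> 'a \<Rightarrow> ennreal" where
  "birkhoff T f n x = (\<Sum>j<n. nsum (\<lambda>y. mpow T j x y * f y))"

text \<open>As subtraction of \<open>ennreal\<close> truncates at 0, this is the recursion
  \<open>h_(n+1) = (f + T h_n - c)^+\<close> with \<open>h_0 = 0\<close>. It dominates the partial
  sums of f - c, increases with n and is never negative.\<close>

fun excursion :: "('a \<Rightarrow> 'a \<Rightarrow> ennreal) \<Rightarrow> ('a \<Rightarrow> ennreal) \<Rightarrow> ennreal \<Rightarrow> nat \<Rightarrow> 'a \<Rightarrow> ennreal" where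
  "excursion T f c 0 x = 0"
| "excursion T f c (Suc n) x = f x + nsum (\<lambda>y. T x y * excursion T f c n y) - c"

lemma birkhoff_Suc:
  fixes T :: "'a::countable \<Rightarrow> 'a \<Rightarrow> ennreal"
  shows "birkhoff T f (Suc n) x = f x + nsum (\<lambda>y. T x y * birkhoff T f n y)"
proof -
  have "birkhoff T f (Suc n) x = nsum (\<lambda>y. mpow T 0 x y * f y)
      + (\<Sum>j<n. nsum (\<lambda>y. mmul T (mpow T j) x y * f y))"
    unfolding birkhoff_def by (subst sum.lessThan_Suc_shift) simp
  also have "nsum (\<lambda>y. mpow T 0 x y * f y) = nsum (\<lambda>y. if y = x then f y else 0)"
    by (intro nn_integral_cong) auto
  also have "\<dots> = f x" by (rule nsum_delta)
  also have "(\<Sum>j<n. nsum (\<lambda>y. mmul T (mpow T j) x y * f y)) = nsum (\<lambda>y. T x y * birkhoff T f n y)"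
    by (simp only: birkhoff_def mmul_apply sum_distrib_left nsum_sum)
  finally show ?thesis .
qed

text \<open>Constants do not grow under a substochastic T, so the n subtractions of c cost at most n
  c in total.\<close>

lemma birkhoff_le_excursion:
  fixes T :: "'a::countable \<Rightarrow> 'a \<Rightarrow> ennreal"
  assumes T: "\<And>x. nsum (T x) \<le> 1"
  shows "birkhoff T f n x \<le> excursion T f c n x + of_nat n * c"
proof (induction n arbitrary: x)
  case 0
  show ?case by (simp add: birkhoff_def)
next
  case (Suc n)
  let ?a = "f x + nsum (\<lambda>y. T x y * excursion T f c n y)"
  have "birkhoff T f (Suc n) x \<le> f x + nsum (\<lambda>y. T x y * (excursion T f c n y + of_nat n * c))"
    unfolding birkhoff_Suc by (intro add_left_mono nsum_mono mult_left_mono Suc) simp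
  also have "\<dots> = ?a + nsum (T x) * (of_nat n * c)"
    by (simp only: distrib_left nsum_add nsum_multc add.assoc)
  also have "\<dots> \<le> ?a + 1 * (of_nat n * c)"
    by (intro add_left_mono mult_right_mono T) simp
  also have "?a \<le> c + (?a - c)"
    using ennreal_minus_le_iff[of ?a c "?a - c"] by auto
  finally show ?case
    by (simp add: distrib_right distrib_left ac_simps add_right_mono)
qed

lemma excursion_le_Suc: "excursion T f c n x \<le> excursion T f c (Suc n) x"
proof (induction n arbitrary: x)
  case (Suc n)
  have "nsum (\<lambda>y. T x y * excursion T f c n y) \<le> nsum (\<lambda>y. T x y * excursion T f c (Suc n) y)"
    by (intro nsum_mono mult_left_mono Suc) simp
  then show ?case
    by (simp only: excursion.simps(2)[of T f c "Suc n"] excursion.simps(2)[of T f c n])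
       (intro ennreal_minus_mono add_left_mono, auto)
qed simp

context stationary_walk
begin

abbreviation "ind \<omega> \<equiv> induced (p \<omega>) (S \<omega>)"

text \<open>Self-adjointness tested against the constant 1, together with row sums at most
  1.\<close>

lemma induced_subinvariant:
  assumes f: "covariant_fun f"
  shows "(\<integral>\<^sup>+\<omega>. w \<omega> 0 * nsum (\<lambda>y. ind \<omega> 0 y * f \<omega> y) \<partial>M) \<le> (\<integral>\<^sup>+\<omega>. w \<omega> 0 * f \<omega> 0 \<partial>M)"
proof -
  have "covariant_fun (\<lambda>_ _. 1)" by (simp add: covariant_fun_def)
  from mass_transport_reversible[OF covariant_induced reversible_induced[OF rev] f this]
  have "(\<integral>\<^sup>+\<omega>. w \<omega> 0 * nsum (\<lambda>y. ind \<omega> 0 y * f \<omega> y) \<partial>M)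
      = (\<integral>\<^sup>+\<omega>. w \<omega> 0 * f \<omega> 0 * nsum (\<lambda>y. ind \<omega> 0 y) \<partial>M)" by simp
  also have "\<dots> \<le> (\<integral>\<^sup>+\<omega>. w \<omega> 0 * f \<omega> 0 * 1 \<partial>M)"
    by (intro nn_integral_mono mult_left_mono induced_row_sum_le row) simp_all
  finally show ?thesis by simp
qed

lemma covariant_excursion:
  assumes f: "covariant_fun f"
  shows "covariant_fun (\<lambda>\<omega>. excursion (ind \<omega>) (f \<omega>) c n)"
proof (induction n)
  case 0
  show ?case by (simp add: covariant_fun_def)
next
  case (Suc n)
  note [measurable] = covariant_funD(1)[OF f] covariant_funD(1)[OF covariant_apply[OF covariant_induced Suc]]
  show ?case
    unfolding covariant_fun_def
  proof (intro conjI allI ballI)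
    show "(\<lambda>\<omega>. excursion (ind \<omega>) (f \<omega>) c (Suc n) x) \<in> borel_measurable M" for x
      by (simp add: birkhoff_Suc)
    fix \<omega> x z
    assume \<omega>: "\<omega> \<in> space M"
    note a = covariant_funD(2)[OF f \<omega>, of z x]
      and b = covariant_funD(2)[OF covariant_apply[OF covariant_induced Suc] \<omega>, of z x]
    show "excursion (ind (\<tau> z \<omega>)) (f (\<tau> z \<omega>)) c (Suc n) x = excursion (ind \<omega>) (f \<omega>) c (Suc n) (x + z)"
      unfolding excursion.simps by (rule arg_cong2[where f = "\<lambda>a b. a + b - c", OF a b])
  qed
qed

lemma covariant_birkhoff:
  assumes f: "covariant_fun f"
  shows "covariant_fun (\<lambda>\<omega>. birkhoff (ind \<omega>) (f \<omega>) n)"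
proof (induction n)
  case 0
  show ?case by (simp add: covariant_fun_def birkhoff_def)
next
  case (Suc n)
  note [measurable] = covariant_funD(1)[OF f] covariant_funD(1)[OF covariant_apply[OF covariant_induced Suc]]
  show ?case
    unfolding covariant_fun_def
  proof (intro conjI allI ballI)
    show "(\<lambda>\<omega>. birkhoff (ind \<omega>) (f \<omega>) (Suc n) x) \<in> borel_measurable M" for x
      by (simp add: birkhoff_Suc)
    fix \<omega> x z
    assume \<omega>: "\<omega> \<in> space M"
    note a = covariant_funD(2)[OF f \<omega>, of z x]
      and b = covariant_funD(2)[OF covariant_apply[OF covariant_induced Suc] \<omega>, of z x]
    show "birkhoff (ind (\<tau> z \<omega>)) (f (\<tau> z \<omega>)) (Suc n) x = birkhoff (ind \<omega>) (f \<omega>) (Suc n) (x + z)"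
      unfolding birkhoff_Suc by (rule arg_cong2[where f = "(+)", OF a b])
  qed
qed

lemma positive_indicator_mono:
  "f \<omega> \<le> g \<omega> \<Longrightarrow> indicator {\<omega>. f \<omega> > 0} \<omega> \<le> (indicator {\<omega>. g \<omega> > (0::ennreal)} \<omega> :: ennreal)"
  by (auto simp: indicator_def dest: order.strict_trans2)

text \<open>Garsia's argument for the Hopf maximal inequality, with the truncated subtraction of
  \<open>ennreal\<close> in the place of the positive part.\<close>

lemma maximal_inequality:
  assumes f: "covariant_fun f" and fin: "(\<integral>\<^sup>+\<omega>. w \<omega> 0 * f \<omega> 0 \<partial>M) < \<top>" and c: "c < \<top>"
  shows "c * (\<integral>\<^sup>+\<omega>. w \<omega> 0 * indicator {\<omega>. \<exists>n. birkhoff (ind \<omega>) (f \<omega>) n 0 > of_nat n * c} \<omega> \<partial>M)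
    \<le> (\<integral>\<^sup>+\<omega>. w \<omega> 0 * f \<omega> 0 \<partial>M)"
proof -
  let ?E = "\<lambda>n \<omega>. excursion (ind \<omega>) (f \<omega>) c n 0"
  let ?I = "\<lambda>n \<omega>. indicator {\<omega>. ?E n \<omega> > 0} \<omega> :: ennreal"
  let ?F = "\<integral>\<^sup>+\<omega>. w \<omega> 0 * f \<omega> 0 \<partial>M"
  note cov = covariant_excursion[OF f]
  note [measurable] = covariant_funD(1)[OF cov] covariant_funD(1)[OF f]
    covariant_funD(1)[OF covariant_apply[OF covariant_induced cov]]
  have step: "(\<integral>\<^sup>+\<omega>. w \<omega> 0 * ?E (Suc n) \<omega> \<partial>M) + c * (\<integral>\<^sup>+\<omega>. w \<omega> 0 * ?I (Suc n) \<omega> \<partial>M)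
      \<le> ?F + (\<integral>\<^sup>+\<omega>. w \<omega> 0 * ?E n \<omega> \<partial>M)" for n
  proof -
    let ?U = "\<lambda>\<omega>. nsum (\<lambda>y. ind \<omega> 0 y * excursion (ind \<omega>) (f \<omega>) c n y)"
    \<comment> \<open>Where the truncated difference is positive the subtraction is exact; elsewhere
      the left side is 0.\<close>
    have *: "(a - c) + c * indicator {\<omega>. g \<omega> > 0} \<omega> \<le> a" if "g \<omega> = a - c"
      for a :: ennreal and g and \<omega> :: 'w
    proof (cases "a - c > 0")
      case True
      then have "c \<le> a" using c by (cases "a \<le> c") (auto simp: diff_eq_0_ennreal)
      then show ?thesis using True that by (simp add: diff_add_cancel_ennreal)
    next
      case False
      then show ?thesis using that by (simp add: not_less)
    qed
    have "(\<integral>\<^sup>+\<omega>. w \<omega> 0 * ?E (Suc n) \<omega> \<partial>M) + c * (\<integral>\<^sup>+\<omega>. w \<omega> 0 * ?I (Suc n) \<omega> \<partial>M)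
        = (\<integral>\<^sup>+\<omega>. w \<omega> 0 * (?E (Suc n) \<omega> + c * ?I (Suc n) \<omega>) \<partial>M)"
      by (simp add: nn_integral_cmult[symmetric] nn_integral_add[symmetric] distrib_left
          mult.left_commute del: excursion.simps)
    also have "\<dots> \<le> (\<integral>\<^sup>+\<omega>. w \<omega> 0 * (f \<omega> 0 + ?U \<omega>) \<partial>M)"
      by (intro nn_integral_mono mult_left_mono)
         (simp_all only: excursion.simps, intro *, simp_all)
    also have "\<dots> = ?F + (\<integral>\<^sup>+\<omega>. w \<omega> 0 * ?U \<omega> \<partial>M)"
      by (simp add: distrib_left nn_integral_add)
    also have "\<dots> \<le> ?F + (\<integral>\<^sup>+\<omega>. w \<omega> 0 * ?E n \<omega> \<partial>M)"
      by (intro add_left_mono induced_subinvariant cov)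
    finally show ?thesis .
  qed
  \<comment> \<open>Needed below, where the integral of the excursion is cancelled on both
    sides.\<close>
  have finite: "(\<integral>\<^sup>+\<omega>. w \<omega> 0 * ?E n \<omega> \<partial>M) < \<top>" for n
  proof (induction n)
    case (Suc n)
    have "(\<integral>\<^sup>+\<omega>. w \<omega> 0 * ?E (Suc n) \<omega> \<partial>M) \<le> ?F + (\<integral>\<^sup>+\<omega>. w \<omega> 0 * ?E n \<omega> \<partial>M)"
      using step[of n] by (rule order_trans[rotated]) simp
    also have "\<dots> < \<top>" using Suc fin by simp
    finally show ?case .
  qed simp
  \<comment> \<open>The excursion increases with n, so its integral on the left of
    \<open>step\<close> may be lowered to the one on the right and then cancelled.\<close>
  have bound: "c * (\<integral>\<^sup>+\<omega>. w \<omega> 0 * ?I n \<omega> \<partial>M) \<le> ?F" for n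
  proof -
    let ?e = "\<integral>\<^sup>+\<omega>. w \<omega> 0 * ?E n \<omega> \<partial>M"
    have I: "(\<integral>\<^sup>+\<omega>. w \<omega> 0 * ?I n \<omega> \<partial>M) \<le> (\<integral>\<^sup>+\<omega>. w \<omega> 0 * ?I (Suc n) \<omega> \<partial>M)"
      by (intro nn_integral_mono mult_left_mono positive_indicator_mono excursion_le_Suc) simp
    have "?e \<le> (\<integral>\<^sup>+\<omega>. w \<omega> 0 * ?E (Suc n) \<omega> \<partial>M)"
      by (intro nn_integral_mono mult_left_mono excursion_le_Suc) simp
    then have "?e + c * (\<integral>\<^sup>+\<omega>. w \<omega> 0 * ?I n \<omega> \<partial>M) \<le> ?e + ?F"
      using order_trans[OF add_mono[OF _ mult_left_mono[OF I]] step[of n]] by (simp add: ac_simps)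
    then show ?thesis
      using finite[of n] by (auto simp: ennreal_add_left_cancel_le)
  qed
  have "(\<integral>\<^sup>+\<omega>. w \<omega> 0 * indicator {\<omega>. \<exists>n. birkhoff (ind \<omega>) (f \<omega>) n 0 > of_nat n * c} \<omega> \<partial>M)
      \<le> (\<integral>\<^sup>+\<omega>. (SUP n. w \<omega> 0 * ?I n \<omega>) \<partial>M)"
  proof (intro nn_integral_mono)
    fix \<omega> assume \<omega>: "\<omega> \<in> space M"
    show "w \<omega> 0 * indicator {\<omega>. \<exists>n. birkhoff (ind \<omega>) (f \<omega>) n 0 > of_nat n * c} \<omega>
        \<le> (SUP n. w \<omega> 0 * ?I n \<omega>)"
    proof (cases "\<exists>n. birkhoff (ind \<omega>) (f \<omega>) n 0 > of_nat n * c")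
      case True
      then obtain n where n: "of_nat n * c < birkhoff (ind \<omega>) (f \<omega>) n 0" ..
      \<comment> \<open>A partial sum above n c forces a positive excursion, so the increasing
        events \<open>?E n \<omega> > 0\<close> cover the maximal event.\<close>
      also have "\<dots> \<le> ?E n \<omega> + of_nat n * c"
        by (intro birkhoff_le_excursion induced_row_sum_le row \<omega>)
      finally have "?E n \<omega> > 0" by (metis add_0 less_irrefl not_gr_zero)
      then have "w \<omega> 0 \<le> w \<omega> 0 * ?I n \<omega>" by simp
      also have "\<dots> \<le> (SUP n. w \<omega> 0 * ?I n \<omega>)" by (intro SUP_upper) simp
      finally show ?thesis by (auto split: split_indicator)
    qed simp
  qed
  also have "\<dots> = (SUP n. \<integral>\<^sup>+\<omega>. w \<omega> 0 * ?I n \<omega> \<partial>M)"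
  proof (rule nn_integral_monotone_convergence_SUP)
    show "incseq (\<lambda>n \<omega>. w \<omega> 0 * ?I n \<omega>)"
    proof (rule incseq_SucI, rule le_funI, intro mult_left_mono)
      show "?I n \<omega> \<le> ?I (Suc n) \<omega>" for n \<omega>
        using excursion_le_Suc[of "ind \<omega>" "f \<omega>" c n 0] by (rule positive_indicator_mono)
    qed simp
    show "(\<lambda>\<omega>. w \<omega> 0 * ?I n \<omega>) \<in> borel_measurable M" for n by measurable
  qed
  finally have "c * (\<integral>\<^sup>+\<omega>. w \<omega> 0 * indicator {\<omega>. \<exists>n. birkhoff (ind \<omega>) (f \<omega>) n 0 > of_nat n * c} \<omega> \<partial>M)
      \<le> (SUP n. c * (\<integral>\<^sup>+\<omega>. w \<omega> 0 * ?I n \<omega> \<partial>M))"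
    by (simp add: SUP_mult_left_ennreal[symmetric] mult_left_mono)
  also have "\<dots> \<le> ?F" by (intro SUP_least bound)
  finally show ?thesis .
qed

text \<open>The integral is a series in the weighted probabilities m k that
  \<open>T_1 = k + 1\<close> from S, with coefficients \<open>(k + 1 - K)^+\<close> that decrease to
  0 as K grows.\<close>

lemma excess_mean_integral_INF:
  assumes fin: "(\<integral>\<^sup>+\<omega>. w \<omega> 0 \<partial>M) < \<top>"
  shows "(INF K. \<integral>\<^sup>+\<omega>. w \<omega> 0 * nsum (excess (p \<omega>) (S \<omega>) K 0) \<partial>M) = 0"
proof -
  define m where "m k = (\<integral>\<^sup>+\<omega>. w \<omega> 0 * (indicator (S \<omega>) 0 * enter_prob (p \<omega>) (S \<omega>) k 0) \<partial>M)" for k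
  note [measurable] = covariant_funD(1)[OF covariant_S] covariantD(1)[OF covariant_taboo]
  have [measurable]: "(\<lambda>\<omega>. enter_prob (p \<omega>) (S \<omega>) k x) \<in> borel_measurable M" for k x
    unfolding enter_prob_def by measurable
  have eq: "(\<integral>\<^sup>+\<omega>. w \<omega> 0 * nsum (excess (p \<omega>) (S \<omega>) K 0) \<partial>M) = nsum (\<lambda>k. of_nat (Suc k - K) * m k)" for K
  proof -
    have "(\<integral>\<^sup>+\<omega>. w \<omega> 0 * nsum (excess (p \<omega>) (S \<omega>) K 0) \<partial>M)
        = (\<integral>\<^sup>+\<omega>. nsum (\<lambda>k. of_nat (Suc k - K) * (w \<omega> 0 * (indicator (S \<omega>) 0 * enter_prob (p \<omega>) (S \<omega>) k 0))) \<partial>M)"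
      by (intro nn_integral_cong) (subst nsum_excess[OF row], simp_all only: nsum_cmult[symmetric] ac_simps)
    also have "\<dots> = nsum (\<lambda>k. of_nat (Suc k - K) * m k)"
      unfolding m_def by (subst nn_integral_count_space_nn_integral) (simp_all add: nn_integral_cmult)
    finally show ?thesis .
  qed
  have dec: "decseq (\<lambda>K k. of_nat (Suc k - K) * m k)"
    by (intro decseq_SucI le_funI mult_right_mono of_nat_mono) auto
  \<comment> \<open>Convergence of decreasing sequences asks for one finite member; Kac's formula
    provides it at K = 0.\<close>
  have 0: "nsum (\<lambda>k. of_nat (Suc k - 0) * m k) < \<infinity>"
    using le_less_trans[OF kac fin] by (simp only: eq infinity_ennreal_def)
  have "(INF K. nsum (\<lambda>k. of_nat (Suc k - K) * m k)) = nsum (\<lambda>k. INF K. of_nat (Suc k - K) * m k)"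
    by (rule nn_integral_monotone_convergence_INF_decseq[OF dec _ 0, symmetric]) simp
  also have "\<dots> = nsum (\<lambda>k::nat. 0)"
  proof (intro nn_integral_cong)
    fix k
    have "(INF K. of_nat (Suc k - K) * m k) \<le> of_nat (Suc k - Suc k) * m k"
      by (intro INF_lower) simp
    then show "(INF K. of_nat (Suc k - K) * m k) = 0" by simp
  qed
  finally show ?thesis by (simp add: eq)
qed

text \<open>The maximal inequality bounds the weight of the set on which every K fails by
  \<open>?F K / c\<close> for each K, hence by 0. Positivity of the weight makes this a null
  set.\<close>

lemma AE_birkhoff_excess_small:
  assumes fin: "(\<integral>\<^sup>+\<omega>. w \<omega> 0 \<partial>M) < \<top>" and pos: "\<And>\<omega>. \<omega> \<in> space M \<Longrightarrow> w \<omega> 0 > 0"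
    and c: "0 < c" "c < \<top>"
  shows "AE \<omega> in M. \<exists>K. \<forall>n. birkhoff (ind \<omega>) (\<lambda>x. nsum (excess (p \<omega>) (S \<omega>) K x)) n 0 \<le> of_nat n * c"
proof -
  let ?f = "\<lambda>K \<omega> x. nsum (excess (p \<omega>) (S \<omega>) K x)"
  let ?N = "{\<omega>. \<forall>K. \<exists>n. birkhoff (ind \<omega>) (?f K \<omega>) n 0 > of_nat n * c}"
  note cov = covariant_excess_mean
  note [measurable] = covariant_funD(1)[OF covariant_birkhoff[OF cov]]
  let ?i = "\<integral>\<^sup>+\<omega>. w \<omega> 0 * indicator ?N \<omega> \<partial>M"
  let ?F = "\<lambda>K. \<integral>\<^sup>+\<omega>. w \<omega> 0 * ?f K \<omega> 0 \<partial>M"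
  have le: "?F K \<le> ?F 0" for K
    unfolding excess_def
    by (intro nn_integral_mono mult_left_mono mult_right_mono of_nat_mono) auto
  have "c * ?i \<le> ?F K" for K
  proof -
    have "c * ?i \<le> c * (\<integral>\<^sup>+\<omega>. w \<omega> 0 * indicator {\<omega>. \<exists>n. birkhoff (ind \<omega>) (?f K \<omega>) n 0 > of_nat n * c} \<omega> \<partial>M)"
      by (intro mult_left_mono nn_integral_mono) (auto split: split_indicator)
    also have "\<dots> \<le> ?F K"
      using le_less_trans[OF order_trans[OF le[of K] kac] fin]
      by (intro maximal_inequality[OF cov _ c(2)])
    finally show ?thesis .
  qed
  then have "c * ?i \<le> (INF K. ?F K)" by (intro INF_greatest)
  then have "?i = 0"
    using c excess_mean_integral_INF[OF fin] by auto
  moreover have "(\<lambda>\<omega>. w \<omega> 0 * indicator ?N \<omega>) \<in> borel_measurable M"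
    by measurable
  ultimately have "AE \<omega> in M. w \<omega> 0 * indicator ?N \<omega> = 0"
    by (subst (asm) nn_integral_0_iff_AE) auto
  with AE_space show ?thesis
  proof eventually_elim
    case (elim \<omega>)
    then have "\<omega> \<notin> ?N" using pos[of \<omega>] by (auto split: split_indicator_asm)
    then show ?case by (simp add: not_less)
  qed
qed

end

section \<open>Return probabilities from a bound on the induced walk\<close>

lemma harm_le_ln: "n > 0 \<Longrightarrow> harm n \<le> ln (real n) + 1"
proof (induction n rule: nat_induct_non_zero)
  case (Suc n)
  have "ln (real n / real (Suc n)) \<le> real n / real (Suc n) - 1"
    using Suc by (intro ln_le_minus_one) simp
  then have "1 / real (Suc n) \<le> ln (real (Suc n)) - ln (real n)"
    using Suc by (simp add: ln_div field_simps)
  with Suc show ?case by (simp add: harm_Suc inverse_eq_divide)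
qed (simp add: harm_def)

text \<open>One fixed environment. The constant D compares \<open>w x\<close> with the weights on S
  and so turns the bound for leaving x into one for reaching x; the decay n^-2 is that of dimension
  four.\<close>

locale trapped_chain =
  fixes p :: "'a::countable \<Rightarrow> 'a \<Rightarrow> ennreal" and w :: "'a \<Rightarrow> ennreal" and S :: "'a set" and x :: 'a
    and D c :: real
  assumes row: "\<And>x. nsum (p x) = 1" and rev: "reversible w p"
    and wx: "w x \<noteq> 0" "w x \<noteq> \<top>" and wy: "\<And>y. y \<in> S \<Longrightarrow> w y \<noteq> 0 \<and> w y \<noteq> \<top> \<and> w x \<le> ennreal D * w y"
    and x: "x \<in> S" and D: "D \<ge> 0" and c: "c \<ge> 0"
    and bound: "\<And>n y. n \<ge> 1 \<Longrightarrow> y \<in> S \<Longrightarrow> mpow (induced p S) n x y \<le> ennreal (c / (real n)\<^sup>2)"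
begin

text \<open>The factor 16 comes from l <= 4 b for b > 0, and D from reversing the path; the summand
  1 covers b = 0, where l = 1.\<close>

lemma induced_return_le:
  assumes "b < l" "l \<le> Suc (2 * b)" "y \<in> S"
  shows "mpow (induced p S) b y x \<le> ennreal ((16 * D * c + 1) / (real l)\<^sup>2)"
proof (cases "b = 0")
  case True
  with assms have "l = 1" by simp
  have "mpow (induced p S) b y x \<le> ennreal 1" using True by simp
  also have "\<dots> \<le> ennreal ((16 * D * c + 1) / (real l)\<^sup>2)"
    using D c \<open>l = 1\<close> by (intro ennreal_leI) simp
  finally show ?thesis .
next
  case False
  let ?T = "mpow (induced p S) b"
  have "w y * ?T y x = w x * ?T x y"
    using reversible_mpow[OF reversible_induced[OF rev], of S b] by (simp add: reversible_def)
  also have "\<dots> \<le> (ennreal D * w y) * ennreal (c / (real b)\<^sup>2)"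
    using wy[OF assms(3)] bound[of b y] False assms(3) by (intro mult_mono) auto
  also have "\<dots> = w y * (ennreal D * ennreal (c / (real b)\<^sup>2))"
    by (simp only: ac_simps)
  also have "ennreal D * ennreal (c / (real b)\<^sup>2) = ennreal (D * c / (real b)\<^sup>2)"
    using D c by (simp add: ennreal_mult[symmetric])
  finally have "?T y x \<le> ennreal (D * c / (real b)\<^sup>2)"
    using wy[OF assms(3)] by (simp add: ennreal_mult_le_mult_iff)
  also have "\<dots> \<le> ennreal ((16 * D * c + 1) / (real l)\<^sup>2)"
  proof (intro ennreal_leI)
    have "real l \<le> 4 * real b" using assms False by linarith
    then have "(real l)\<^sup>2 \<le> (4 * real b)\<^sup>2" by (intro power_mono) auto
    then have "D * c * (real l)\<^sup>2 \<le> D * c * (16 * (real b)\<^sup>2)"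
      using D c by (intro mult_left_mono) (auto simp: power_mult_distrib)
    also have "\<dots> \<le> (16 * D * c + 1) * (real b)\<^sup>2"
      by (simp add: algebra_simps)
    finally show "D * c / (real b)\<^sup>2 \<le> (16 * D * c + 1) / (real l)\<^sup>2"
      using False assms by (simp add: divide_simps)
  qed
  finally show ?thesis .
qed

text \<open>Averaging over a window of even times and sorting by the number l of induced steps
  yields terms \<open>G l\<close>, each controlled by the mean excess if l K <= n and by the decay
  of the induced walk otherwise.\<close>

lemma mpow_4_le:
  fixes \<epsilon> :: real
  assumes \<epsilon>: "\<epsilon> \<ge> 0" and n: "n \<ge> 1"
    and K: "\<And>l. birkhoff (induced p S) (\<lambda>y. nsum (excess p S K y)) l x \<le> of_nat l * ennreal \<epsilon>"
  shows "mpow p (4 * n) x x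
    \<le> ennreal ((2 * (16 * D * c + 1) * \<epsilon> * harm (4 * n) + 4 * c * (real K)\<^sup>2) / (real n)\<^sup>2)"
proof -
  let ?T = "mpow (induced p S)"
  \<comment> \<open>Weight of closed paths at x with l induced steps and even total duration in (2n,
    4n].\<close>
  define G where "G l = (\<Sum>m\<in>{n<..2 * n}. clock p S l (2 * m) x x)" for l
  define B where "B = 16 * D * c + 1"
  have B: "B \<ge> 0" using D c by (simp add: B_def)
  have G0: "G 0 = 0" by (simp add: G_def)
  have excess: "excess_sum p S K l x x \<le> ennreal (2 * B * \<epsilon> / real l)" if "l \<ge> 1" for l
  proof -
    have "excess_sum p S K l x x
        \<le> 2 * ennreal (B / (real l)\<^sup>2) * birkhoff (induced p S) (\<lambda>y. nsum (excess p S K y)) l x"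
      unfolding birkhoff_def B_def by (rule excess_sum_le[OF rev wx induced_return_le])
    also have "\<dots> \<le> 2 * ennreal (B / (real l)\<^sup>2) * (of_nat l * ennreal \<epsilon>)"
      by (intro mult_left_mono K) simp
    also have "\<dots> = ennreal (2 * (B / (real l)\<^sup>2) * (real l * \<epsilon>))"
      using B \<epsilon> by (simp add: ennreal_mult ennreal_of_nat_eq_real_of_nat
          del: times_divide_eq_left times_divide_eq_right)
    also have "2 * (B / (real l)\<^sup>2) * (real l * \<epsilon>) = 2 * B * \<epsilon> / real l"
      using that by (simp add: field_simps power2_eq_square)
    finally show ?thesis .
  qed
  have G_le: "of_nat n * G l \<le> ennreal (2 * B * \<epsilon> / real l + c * (real K)\<^sup>2 / real n)" if l: "l \<ge> 1" for l
  proof (cases "l * K \<le> n")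
    \<comment> \<open>The duration 2m is above 2n, so it exceeds l K by at least n; this is Markov's
      inequality for the excess.\<close>
    case True
    have "of_nat n * G l \<le> (\<Sum>m\<in>{n<..2 * n}. of_nat (2 * m - l * K) * clock p S l (2 * m) x x)"
      unfolding G_def sum_distrib_left
      using True by (intro sum_mono mult_right_mono of_nat_mono) auto
    also have "\<dots> = (\<Sum>m\<in>(\<lambda>m. 2 * m) ` {n<..2 * n}. of_nat (m - l * K) * clock p S l m x x)"
      by (subst sum.reindex) (auto simp: inj_on_def)
    also have "\<dots> \<le> nsum (\<lambda>m. of_nat (m - l * K) * clock p S l m x x)"
      by (intro sum_le_nsum) simp
    also have "\<dots> \<le> ennreal (2 * B * \<epsilon> / real l)"
      using nsum_excess_clock_le excess[OF l] by (rule order_trans)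
    also have "\<dots> \<le> ennreal (2 * B * \<epsilon> / real l + c * (real K)\<^sup>2 / real n)"
      using c by (intro ennreal_leI) simp
    finally show ?thesis .
  next
    \<comment> \<open>Now l > n / K, and the decay c / l^2 is below c K^2 / n^2.\<close>
    case False
    have "G l = (\<Sum>m\<in>(\<lambda>m. 2 * m) ` {n<..2 * n}. clock p S l m x x)"
      unfolding G_def by (subst sum.reindex) (auto simp: inj_on_def)
    also have "\<dots> \<le> ?T l x x"
      unfolding nsum_clock[symmetric] by (intro sum_le_nsum) simp
    also have "\<dots> \<le> ennreal (c / (real l)\<^sup>2)"
      using l x by (rule bound)
    also have "\<dots> \<le> ennreal (c * (real K)\<^sup>2 / (real n)\<^sup>2)"
    proof (intro ennreal_leI)
      have "real n \<le> real l * real K"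
        using False by (simp only: of_nat_mult[symmetric] of_nat_le_iff not_le)
      then have "(real n)\<^sup>2 \<le> (real l * real K)\<^sup>2" by (intro power_mono) auto
      then have "c * (real n)\<^sup>2 \<le> c * (real l * real K)\<^sup>2" using c by (rule mult_left_mono)
      then show "c / (real l)\<^sup>2 \<le> c * (real K)\<^sup>2 / (real n)\<^sup>2"
        using n l by (simp add: divide_simps power_mult_distrib ac_simps)
    qed
    finally have "of_nat n * G l \<le> of_nat n * ennreal (c * (real K)\<^sup>2 / (real n)\<^sup>2)"
      by (intro mult_left_mono zero_le)
    also have "\<dots> = ennreal (c * (real K)\<^sup>2 / real n)"
      using c n by (simp add: ennreal_mult[symmetric] ennreal_of_nat_eq_real_of_nat power2_eq_square)
    also have "\<dots> \<le> ennreal (2 * B * \<epsilon> / real l + c * (real K)\<^sup>2 / real n)"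
      using B \<epsilon> by (intro ennreal_leI) simp
    finally show ?thesis .
  qed
  have dec: "decseq (\<lambda>n. mpow p (2 * n) x x)"
    by (rule decseq_SucI) (rule mpow_even_decreasing[OF row rev wx])
  \<comment> \<open>Among the n even times 2m with n < m <= 2n, the last one has the smallest return
    probability.\<close>
  have "of_nat n * mpow p (4 * n) x x = (\<Sum>m\<in>{n<..2 * n}. mpow p (2 * (2 * n)) x x)"
    by simp
  also have "\<dots> \<le> (\<Sum>m\<in>{n<..2 * n}. mpow p (2 * m) x x)"
    by (intro sum_mono decseqD[OF dec]) simp
  also have "\<dots> = (\<Sum>m\<in>{n<..2 * n}. \<Sum>l\<le>2 * m. clock p S l (2 * m) x x)"
    by (simp only: mpow_eq_sum_clock[OF x x])
  also have "\<dots> \<le> (\<Sum>m\<in>{n<..2 * n}. \<Sum>l\<le>4 * n. clock p S l (2 * m) x x)"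
    by (intro sum_mono sum_mono2) auto
  also have "\<dots> = (\<Sum>l\<le>4 * n. G l)"
    unfolding G_def by (rule sum.swap)
  also have "\<dots> = (\<Sum>l=1..4 * n. G l)"
    using G0 by (intro sum.mono_neutral_right) (auto simp: not_less_eq_eq)
  finally have "of_nat n * (of_nat n * mpow p (4 * n) x x) \<le> of_nat n * (\<Sum>l=1..4 * n. G l)"
    by (intro mult_left_mono zero_le)
  also have "\<dots> \<le> (\<Sum>l=1..4 * n. ennreal (2 * B * \<epsilon> / real l + c * (real K)\<^sup>2 / real n))"
    unfolding sum_distrib_left by (intro sum_mono G_le) simp
  also have "\<dots> = ennreal (\<Sum>l=1..4 * n. 2 * B * \<epsilon> / real l + c * (real K)\<^sup>2 / real n)"
    using B \<epsilon> c by (intro sum_ennreal) simp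
  \<comment> \<open>The second term does not depend on l and occurs 4n times, hence 4 c K^2.\<close>
  also have "(\<Sum>l=1..4 * n. 2 * B * \<epsilon> / real l + c * (real K)\<^sup>2 / real n)
      = 2 * B * \<epsilon> * harm (4 * n) + 4 * c * (real K)\<^sup>2"
    using n by (simp add: sum.distrib harm_def sum_distrib_left divide_inverse)
  finally have *: "of_nat n * (of_nat n * mpow p (4 * n) x x)
      \<le> ennreal (2 * B * \<epsilon> * harm (4 * n) + 4 * c * (real K)\<^sup>2)" (is "_ \<le> ennreal ?r") .
  have "0 \<le> ?r" using B \<epsilon> c by (simp add: harm_nonneg)
  have "of_nat n * (of_nat n * mpow p (4 * n) x x) = ennreal ((real n)\<^sup>2) * mpow p (4 * n) x x"
    by (simp add: power2_eq_square ennreal_mult ennreal_of_nat_eq_real_of_nat mult.assoc)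
  moreover have "ennreal ?r = ennreal ((real n)\<^sup>2) * ennreal (?r / (real n)\<^sup>2)"
    using \<open>0 \<le> ?r\<close> n by (simp add: ennreal_mult[symmetric])
  ultimately have "mpow p (4 * n) x x \<le> ennreal (?r / (real n)\<^sup>2)"
    using * n by (simp add: ennreal_mult_le_mult_iff)
  then show ?thesis by (simp add: B_def)
qed

text \<open>Given delta, first \<epsilon> and then K are fixed; the K^2 term is of order n^-2 and is
  absorbed by the logarithm for large n.\<close>

lemma return_prob_smallo:
  assumes h: "\<And>n. ennreal (h n) = mpow p n x x" "\<And>n. h n \<ge> 0"
    and small: "\<And>\<epsilon>. \<epsilon> > 0 \<Longrightarrow> \<exists>K. \<forall>l. birkhoff (induced p S) (\<lambda>y. nsum (excess p S K y)) l x \<le> of_nat l * ennreal \<epsilon>"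
  shows "(\<lambda>n. h (2 * n)) \<in> o(\<lambda>n. ln (real n) / (real n)\<^sup>2)"
proof (rule landau_o.smallI)
  fix \<delta> :: real assume \<delta>: "\<delta> > 0"
  define B where "B = 16 * D * c + 1"
  have B: "B > 0" using D c by (simp add: B_def add_nonneg_pos)
  \<comment> \<open>The factor 36 makes 9 * 2 B \<epsilon> equal to delta / 2, where 9 is the loss
    from n <= 3 N below.\<close>
  define \<epsilon> where "\<epsilon> = \<delta> / (36 * B)"
  have \<epsilon>: "\<epsilon> > 0" using \<delta> B by (simp add: \<epsilon>_def)
  from small[OF \<epsilon>] obtain K
    where K: "\<And>l. birkhoff (induced p S) (\<lambda>y. nsum (excess p S K y)) l x \<le> of_nat l * ennreal \<epsilon>"
    by blast
  \<comment> \<open>All terms without ln n; the logarithmic threshold that follows makes R at most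
    (delta / 2) ln n.\<close>
  define R where "R = \<delta> / 2 * (ln 4 + 1) + 36 * c * (real K)\<^sup>2"
  have "filterlim (\<lambda>n. ln (real n)) at_top sequentially"
    by (rule filterlim_compose[OF ln_at_top filterlim_real_sequentially])
  then have "eventually (\<lambda>n. ln (real n) \<ge> 2 * R / \<delta>) sequentially"
    by (simp add: filterlim_at_top)
  then show "eventually (\<lambda>n. norm (h (2 * n)) \<le> \<delta> * norm (ln (real n) / (real n)\<^sup>2)) sequentially"
    using eventually_ge_at_top[of 3]
  proof eventually_elim
    case (elim n)
    \<comment> \<open>The bound is for times divisible by 4. The time 4 N is at most 2 n, so
      monotonicity along even times covers both parities of n.\<close>
    define N where "N = n div 2"
    have N: "N \<ge> 1" "N \<le> n" "real n \<le> 3 * real N" using elim(2) by (auto simp: N_def)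
    have dec: "decseq (\<lambda>n. mpow p (2 * n) x x)"
      by (rule decseq_SucI) (rule mpow_even_decreasing[OF row rev wx])
    have "ennreal (h (2 * n)) \<le> ennreal (h (4 * N))"
      using decseqD[OF dec, of "2 * N" n] by (simp add: h N_def)
    also have "\<dots> \<le> ennreal ((2 * B * \<epsilon> * harm (4 * N) + 4 * c * (real K)\<^sup>2) / (real N)\<^sup>2)"
      unfolding h B_def using \<epsilon> N(1) K by (intro mpow_4_le) auto
    finally have "h (2 * n) \<le> (2 * B * \<epsilon> * harm (4 * N) + 4 * c * (real K)\<^sup>2) / (real N)\<^sup>2"
      using B \<epsilon> c by (subst (asm) ennreal_le_iff) (auto intro!: divide_nonneg_nonneg add_nonneg_nonneg mult_nonneg_nonneg harm_nonneg)
    also have "\<dots> \<le> (2 * B * \<epsilon> * (ln (real n) + ln 4 + 1) + 4 * c * (real K)\<^sup>2) / (real N)\<^sup>2"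
    proof -
      have "harm (4 * N) \<le> ln (real (4 * N)) + 1" using N by (intro harm_le_ln) simp
      also have "ln (real (4 * N)) = ln 4 + ln (real N)" using N by (simp add: ln_mult)
      also have "ln (real N) \<le> ln (real n)" using N by simp
      finally show ?thesis
        using B \<epsilon> by (intro divide_right_mono add_right_mono mult_left_mono) auto
    qed
    also have "\<dots> \<le> (2 * B * \<epsilon> * (ln (real n) + ln 4 + 1) + 4 * c * (real K)\<^sup>2) * (9 / (real n)\<^sup>2)"
    proof -
      have "(real n)\<^sup>2 \<le> (3 * real N)\<^sup>2" using N by (intro power_mono) auto
      then have "1 / (real N)\<^sup>2 \<le> 9 / (real n)\<^sup>2"
        using N elim(2) by (simp add: divide_simps power_mult_distrib)
      moreover have "0 \<le> 2 * B * \<epsilon> * (ln (real n) + ln 4 + 1) + 4 * c * (real K)\<^sup>2"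
        using B \<epsilon> c elim(2) by (intro add_nonneg_nonneg mult_nonneg_nonneg) auto
      ultimately show ?thesis by (metis mult_left_mono times_divide_eq_right mult_1_right)
    qed
    also have "\<dots> = (\<delta> / 2 * ln (real n) + R) / (real n)\<^sup>2"
    proof -
      have eq: "2 * B * \<epsilon> = \<delta> / 18" using B by (simp add: \<epsilon>_def)
      have "(2 * B * \<epsilon> * (ln (real n) + ln 4 + 1) + 4 * c * (real K)\<^sup>2) * 9 = \<delta> / 2 * ln (real n) + R"
        unfolding eq R_def by (simp add: algebra_simps)
      then show ?thesis by (simp only: times_divide_eq_right)
    qed
    also have "\<dots> \<le> \<delta> * ln (real n) / (real n)\<^sup>2"
      using elim(1) \<delta> by (intro divide_right_mono) (auto simp: field_simps)
    finally show ?case using h(2)[of "2 * n"] elim(2) by simp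
  qed
qed

end

section \<open>The trajectory measure\<close>

abbreviation step :: "('d::finite) env \<Rightarrow> int ^ 'd \<Rightarrow> int ^ 'd \<Rightarrow> ennreal" where
  "step \<omega> x y \<equiv> ennreal (trans_prob \<omega> x y)"

text \<open>Common form of the finite-dimensional laws: unrestricted A gives powers of the kernel,
  and A equal to the complement of S at inner times gives \<open>taboo\<close>.\<close>

fun path_weight :: "('d::finite) env \<Rightarrow> (nat \<Rightarrow> (int ^ 'd) set) \<Rightarrow> int ^ 'd \<Rightarrow> nat \<Rightarrow> int ^ 'd \<Rightarrow> ennreal" where
  "path_weight \<omega> A x 0 y = (if x = y then indicator (A 0) y else 0)"
| "path_weight \<omega> A x (Suc n) y = nsum (\<lambda>z. path_weight \<omega> A x n z * step \<omega> z y) * indicator (A (Suc n)) y"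

lemma path_weight_mpow:
  assumes "\<And>i. i \<le> n \<Longrightarrow> A i = UNIV"
  shows "path_weight \<omega> A x n y = mpow (step \<omega>) n x y"
  using assms
proof (induction n arbitrary: y)
  case (Suc n)
  then show ?case
    unfolding mpow_Suc2 by (simp add: mmul_def)
qed simp

lemma path_weight_avoid:
  assumes "A 0 = UNIV" "\<And>i. 0 < i \<Longrightarrow> i \<le> n \<Longrightarrow> A i = - S"
  shows "path_weight \<omega> A x n y = mpow (avoid (step \<omega>) S) n x y"
  using assms
proof (induction n arbitrary: y)
  case (Suc n)
  then have "path_weight \<omega> A x (Suc n) y
      = nsum (\<lambda>z. mpow (avoid (step \<omega>) S) n x z * step \<omega> z y) * indicator (- S) y"
    by simp
  then show ?case
    unfolding mpow_Suc2 mmul_def avoid_def[of _ _ _ y] by (simp only: nsum_multc mult.assoc[symmetric])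
qed simp

lemma path_weight_taboo:
  assumes "A 0 = UNIV" "\<And>i. 0 < i \<Longrightarrow> i \<le> n \<Longrightarrow> A i = - S" "A (Suc n) = {y}"
  shows "path_weight \<omega> A x (Suc n) y = taboo (step \<omega>) S n x y"
  using assms by (simp add: path_weight_avoid taboo_def mmul_def)

context
  fixes \<omega> :: "('d::finite) env" and x :: "int ^ 'd"
  assumes row: "\<And>x. nsum (step \<omega> x) = 1"
begin

lemma prob_space_step: "prob_space (point_measure UNIV (step \<omega> y))"
  by (intro prob_spaceI) (simp add: point_measure_def emeasure_density row)

lemma Ionescu_Tulcea_step: "Ionescu_Tulcea (step_kernel \<omega> x) (\<lambda>_. count_space UNIV)"
proof (rule Ionescu_Tulcea.intro)
  fix i
  show "step_kernel \<omega> x i \<in> measurable (Pi\<^sub>M {0..<i} (\<lambda>_. count_space UNIV))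
      (subprob_algebra (count_space UNIV))"
  proof (cases i)
    case 0
    have "return (count_space UNIV) x \<in> space (subprob_algebra (count_space UNIV))"
      by (simp add: space_subprob_algebra prob_space_return prob_space_imp_subprob_space)
    moreover have "step_kernel \<omega> x i = (\<lambda>_. return (count_space UNIV) x)"
      by (intro ext) (simp add: 0)
    ultimately show ?thesis by simp
  next
    case (Suc n)
    have "(\<lambda>X. X n) \<in> measurable (Pi\<^sub>M {0..<i} (\<lambda>_. count_space UNIV)) (count_space (UNIV :: (int ^ 'd) set))"
      by (rule measurable_component_singleton) (simp add: Suc)
    moreover have "(\<lambda>y. point_measure UNIV (step \<omega> y)) \<in> measurable (count_space UNIV)
        (subprob_algebra (count_space UNIV))"
      by (auto simp: space_subprob_algebra sets_point_measure
          intro!: prob_space_imp_subprob_space prob_space_step)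
    ultimately have "(\<lambda>X. point_measure UNIV (step \<omega> (X n)))
        \<in> measurable (Pi\<^sub>M {0..<i} (\<lambda>_. count_space UNIV)) (subprob_algebra (count_space UNIV))"
      by (rule measurable_compose)
    moreover have "step_kernel \<omega> x i = (\<lambda>X. point_measure UNIV (step \<omega> (X n)))"
      by (intro ext) (simp add: Suc)
    ultimately show ?thesis by simp
  qed
  show "prob_space (step_kernel \<omega> x i X)" for X
    by (cases i) (simp_all add: prob_space_return prob_space_step)
qed

interpretation IT: Ionescu_Tulcea "step_kernel \<omega> x" "\<lambda>_. count_space UNIV"
  by (rule Ionescu_Tulcea_step)

lemma walk_law_eq: "walk_law \<omega> x = IT.PF.lim"
  by (simp add: walk_law_def)

lemma measurable_coordinate:
  fixes f :: "int ^ 'd \<Rightarrow> ennreal"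
  assumes "i \<in> I"
  shows "(\<lambda>X. f (X i)) \<in> borel_measurable (Pi\<^sub>M I (\<lambda>_. count_space UNIV))"
  by (rule measurable_compose[OF measurable_component_singleton[OF assms]]) simp

text \<open>Integrating out the last step replaces the test function h by its mean after one step,
  so the induction runs over arbitrary h.\<close>

lemma nn_integral_path:
  fixes h :: "int ^ 'd \<Rightarrow> ennreal"
  shows "(\<integral>\<^sup>+X. (\<Prod>i\<le>n. indicator (A i) (X i)) * h (X n) \<partial>IT.C 0 (Suc n) (\<lambda>_. undefined))
    = nsum (\<lambda>y. path_weight \<omega> A x n y * h y)"
proof (induction n arbitrary: h)
  case 0
  have m: "(\<lambda>X. indicator (A 0) (X 0) * h (X 0)) \<in> borel_measurable (Pi\<^sub>M {0..<Suc 0} (\<lambda>_. count_space UNIV))"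
    by (rule measurable_coordinate) simp
  have u: "(\<lambda>_. undefined) \<in> space (Pi\<^sub>M {0..<0} (\<lambda>_. count_space (UNIV :: (int ^ 'd) set)))"
    by (auto simp: space_PiM)
  have "(\<integral>\<^sup>+X. indicator (A 0) (X 0) * h (X 0) \<partial>IT.C 0 (Suc 0) (\<lambda>_. undefined))
      = (\<integral>\<^sup>+X. indicator (A 0) (X 0) * h (X 0) \<partial>IT.eP 0 (\<lambda>_. undefined))"
    using bind_return[OF IT.measurable_eP[of 0] u] by simp
  also have "\<dots> = (\<integral>\<^sup>+y. indicator (A 0) y * h y \<partial>step_kernel \<omega> x 0 (\<lambda>_. undefined))"
    by (subst IT.nn_integral_eP[OF u m]) simp
  also have "\<dots> = indicator (A 0) x * h x"
    by (simp add: nn_integral_return)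
  also have "\<dots> = nsum (\<lambda>y. if y = x then indicator (A 0) y * h y else 0)"
    by (rule nsum_delta[symmetric])
  also have "\<dots> = nsum (\<lambda>y. path_weight \<omega> A x 0 y * h y)"
    by (intro nn_integral_cong) auto
  finally show ?case by simp
next
  case (Suc n)
  let ?P = "\<lambda>n. Pi\<^sub>M {0..<n} (\<lambda>_. count_space (UNIV :: (int ^ 'd) set))"
  let ?f = "\<lambda>X. (\<Prod>i\<le>Suc n. indicator (A i) (X i)) * h (X (Suc n)) :: ennreal"
  let ?h = "\<lambda>z. nsum (\<lambda>y. step \<omega> z y * (indicator (A (Suc n)) y * h y))"
  have u: "(\<lambda>_. undefined) \<in> space (?P 0)"
    by (auto simp: space_PiM)
  have m: "?f \<in> borel_measurable (?P (Suc (Suc n)))"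
    by (intro borel_measurable_times_ennreal borel_measurable_prod_ennreal measurable_coordinate) auto
  have "(\<integral>\<^sup>+X. ?f X \<partial>IT.C 0 (Suc (Suc n)) (\<lambda>_. undefined))
      = (\<integral>\<^sup>+X. ?f X \<partial>(IT.C 0 (Suc n) (\<lambda>_. undefined) \<bind> IT.eP (Suc n)))"
    by (simp only: IT.C.simps(2)[of 0 "Suc n"] add_0)
  also have "\<dots> = (\<integral>\<^sup>+X. \<integral>\<^sup>+Y. ?f Y \<partial>IT.eP (Suc n) X \<partial>IT.C 0 (Suc n) (\<lambda>_. undefined))"
  proof (rule nn_integral_bind[OF m])
    show "IT.eP (Suc n) \<in> measurable (IT.C 0 (Suc n) (\<lambda>_. undefined)) (subprob_algebra (?P (Suc (Suc n))))"
      using IT.measurable_eP[of "Suc n"]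
      by (simp only: measurable_cong_sets[OF IT.sets_C[OF u, of "Suc n"] refl] add_0)
  qed
  also have "\<dots> = (\<integral>\<^sup>+X. (\<Prod>i\<le>n. indicator (A i) (X i)) * ?h (X n) \<partial>IT.C 0 (Suc n) (\<lambda>_. undefined))"
  proof (intro nn_integral_cong)
    fix X assume "X \<in> space (IT.C 0 (Suc n) (\<lambda>_. undefined))"
    then have X: "X \<in> space (?P (Suc n))"
      using IT.space_C[OF u, of "Suc n"] by simp
    have "(\<integral>\<^sup>+Y. ?f Y \<partial>IT.eP (Suc n) X) = (\<integral>\<^sup>+y. ?f (X(Suc n := y)) \<partial>step_kernel \<omega> x (Suc n) X)"
      by (rule IT.nn_integral_eP[OF X m])
    also have "\<dots> = (\<integral>\<^sup>+y. (\<Prod>i\<le>n. indicator (A i) (X i)) * (indicator (A (Suc n)) y * h y)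
        \<partial>point_measure UNIV (step \<omega> (X n)))"
      by (simp add: mult.assoc)
    also have "\<dots> = (\<Prod>i\<le>n. indicator (A i) (X i)) * ?h (X n)"
      by (simp add: point_measure_def nn_integral_density nsum_cmult[symmetric] ac_simps)
    finally show "(\<integral>\<^sup>+Y. ?f Y \<partial>IT.eP (Suc n) X) = (\<Prod>i\<le>n. indicator (A i) (X i)) * ?h (X n)" .
  qed
  also have "\<dots> = nsum (\<lambda>z. path_weight \<omega> A x n z * ?h z)"
    by (rule Suc)
  also have "\<dots> = nsum (\<lambda>z. nsum (\<lambda>y. path_weight \<omega> A x n z * step \<omega> z y * (indicator (A (Suc n)) y * h y)))"
    by (simp add: nsum_cmult[symmetric] mult.assoc)
  also have "\<dots> = nsum (\<lambda>y. nsum (\<lambda>z. path_weight \<omega> A x n z * step \<omega> z y * (indicator (A (Suc n)) y * h y)))"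
    by (rule nsum_swap)
  also have "\<dots> = nsum (\<lambda>y. path_weight \<omega> A x (Suc n) y * h y)"
    by (simp only: path_weight.simps nsum_multc mult.assoc[symmetric])
  finally show ?case .
qed

lemma space_walk_law [simp]: "space (walk_law \<omega> x) = UNIV"
  by (simp add: walk_law_eq space_PiM)

lemma prob_space_walk_law: "prob_space (walk_law \<omega> x)"
  
proof
  \<comment> \<open>The cylinder over no coordinates is the whole trajectory space.\<close>
  have "emeasure IT.PF.lim (IT.PF.emb UNIV {} {\<lambda>_. undefined}) = emeasure (IT.CI {}) {\<lambda>_. undefined}"
    by (rule IT.lim) (simp_all add: PiM_empty)
  also have "\<dots> = 1"
    using prob_space.emeasure_space_1[OF IT.PF.prob_space_P[of "{}"]] by (simp add: IT.PF.space_P PiM_empty)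
  also have "IT.PF.emb UNIV {} {\<lambda>_. undefined} = space (walk_law \<omega> x)"
    by (auto simp: prod_emb_def space_PiM walk_law_eq)
  finally show "emeasure (walk_law \<omega> x) (space (walk_law \<omega> x)) = 1"
    by (simp only: walk_law_eq)
qed

lemma sets_walk_law [measurable_cong]: "sets (walk_law \<omega> x) = sets (Pi\<^sub>M UNIV (\<lambda>_. count_space UNIV))"
  by (simp add: walk_law_eq)

lemma measurable_walk_coordinate [measurable]:
  "(\<lambda>X. X i) \<in> measurable (walk_law \<omega> x) (count_space UNIV)"
  using measurable_component_singleton[of i UNIV "\<lambda>_. count_space (UNIV :: (int ^ 'd) set)"]
  by (simp add: measurable_cong_sets[OF sets_walk_law refl])

text \<open>The event is a cylinder over times 0 to n; fixing the last position at y leaves one term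
  of the sum over endpoints.\<close>

lemma emeasure_walk_path:
  assumes y: "A n = {y}"
  shows "emeasure (walk_law \<omega> x) {X. \<forall>i\<le>n. X i \<in> A i} = path_weight \<omega> A x n y"
proof -
  let ?J = "{0..<Suc n}"
  let ?P = "Pi\<^sub>M ?J (\<lambda>_. count_space (UNIV :: (int ^ 'd) set))"
  have sets: "(\<Pi>\<^sub>E i\<in>?J. A i) \<in> sets ?P"
    by (intro sets_PiM_I_finite) auto
  have u: "(\<lambda>_. undefined) \<in> space (Pi\<^sub>M {0..<0} (\<lambda>_. count_space (UNIV :: (int ^ 'd) set)))"
    by (auto simp: space_PiM)
  have "{X. \<forall>i\<le>n. X i \<in> A i} = IT.PF.emb UNIV ?J (\<Pi>\<^sub>E i\<in>?J. A i)"
    by (auto simp: prod_emb_def space_PiM PiE_iff less_Suc_eq_le)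
  then have "emeasure (walk_law \<omega> x) {X. \<forall>i\<le>n. X i \<in> A i} = emeasure (IT.CI ?J) (\<Pi>\<^sub>E i\<in>?J. A i)"
    unfolding walk_law_eq using IT.lim[OF _ sets] by simp
  also have "\<dots> = emeasure (IT.C 0 (Suc n) (\<lambda>_. undefined)) (IT.PF.emb ?J ?J (\<Pi>\<^sub>E i\<in>?J. A i))"
    by (rule IT.emeasure_CI[OF _ sets]) simp
  also have "IT.PF.emb ?J ?J (\<Pi>\<^sub>E i\<in>?J. A i) = (\<Pi>\<^sub>E i\<in>?J. A i)"
    using sets.sets_into_space[OF sets] by (intro prod_emb_id) (simp add: space_PiM)
  also have "emeasure (IT.C 0 (Suc n) (\<lambda>_. undefined)) (\<Pi>\<^sub>E i\<in>?J. A i)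
      = (\<integral>\<^sup>+X. indicator (\<Pi>\<^sub>E i\<in>?J. A i) X \<partial>IT.C 0 (Suc n) (\<lambda>_. undefined))"
    using sets IT.sets_C[OF u, of "Suc n"] by (intro nn_integral_indicator[symmetric]) simp
  also have "\<dots> = (\<integral>\<^sup>+X. (\<Prod>i\<le>n. indicator (A i) (X i)) * 1 \<partial>IT.C 0 (Suc n) (\<lambda>_. undefined))"
  proof (intro nn_integral_cong)
    fix X assume "X \<in> space (IT.C 0 (Suc n) (\<lambda>_. undefined))"
    then have "X \<in> extensional ?J"
      using IT.space_C[OF u, of "Suc n"] by (simp add: space_PiM PiE_def)
    then show "indicator (\<Pi>\<^sub>E i\<in>?J. A i) X = (\<Prod>i\<le>n. indicator (A i) (X i)) * (1 :: ennreal)"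
      by (auto simp: indicator_def PiE_iff less_Suc_eq_le intro!: prod_zero[symmetric])
  qed
  also have "\<dots> = nsum (\<lambda>z. path_weight \<omega> A x n z * 1)"
    by (rule nn_integral_path)
  also have "\<dots> = nsum (\<lambda>z. if z = y then path_weight \<omega> A x n z else 0)"
    using y by (intro nn_integral_cong) (cases n, auto)
  finally show ?thesis by (simp only: nsum_delta)
qed

lemma ennreal_heat_kernel: "ennreal (heat_kernel \<omega> n x y) = mpow (step \<omega>) n x y"
proof -
  interpret prob_space "walk_law \<omega> x" by (rule prob_space_walk_law)
  let ?A = "\<lambda>i. if i = n then {y} else UNIV"
  have "ennreal (heat_kernel \<omega> n x y) = emeasure (walk_law \<omega> x) {X. X n = y}"
    by (simp add: heat_kernel_def emeasure_eq_measure)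
  also have "{X. X n = y} = {X. \<forall>i\<le>n. X i \<in> ?A i}" by auto
  also have "emeasure (walk_law \<omega> x) \<dots> = path_weight \<omega> ?A x n y"
    by (rule emeasure_walk_path) simp
  also have "\<dots> = mpow (step \<omega>) n x y"
  proof (cases n)
    case (Suc m)
    have "path_weight \<omega> ?A x m z = mpow (step \<omega>) m x z" for z
      by (rule path_weight_mpow) (simp add: Suc)
    then show ?thesis
      unfolding Suc mpow_Suc2 by (simp add: mmul_def)
  qed simp
  finally show ?thesis .
qed

text \<open>Replaces the infimum by conditions on finitely many coordinates, so that events about
  the return time become cylinders.\<close>

lemma return_time_eq_iff:
  "return_time S X = enat n \<longleftrightarrow> n > 0 \<and> X n \<in> S \<and> (\<forall>i. 0 < i \<and> i < n \<longrightarrow> X i \<notin> S)"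
proof
  let ?A = "{n. n > 0 \<and> X n \<in> S}"
  assume eq: "return_time S X = enat n"
  then have "?A \<noteq> {}" by (auto simp: return_time_def Inf_enat_def split: if_splits)
  then obtain m where "enat m \<in> enat ` ?A" by blast
  then have "(LEAST k. k \<in> enat ` ?A) \<in> enat ` ?A" by (rule LeastI)
  with \<open>?A \<noteq> {}\<close> have "Inf (enat ` ?A) \<in> enat ` ?A"
    by (simp only: Inf_enat_def image_is_empty if_False)
  with eq have "n \<in> ?A" by (auto simp: return_time_def)
  moreover have "i \<notin> ?A" if "i < n" for i
  proof
    assume "i \<in> ?A"
    then have "Inf (enat ` ?A) \<le> enat i" by (intro Inf_lower) auto
    with eq that show False by (simp add: return_time_def)
  qed
  ultimately show "n > 0 \<and> X n \<in> S \<and> (\<forall>i. 0 < i \<and> i < n \<longrightarrow> X i \<notin> S)" by auto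
next
  assume *: "n > 0 \<and> X n \<in> S \<and> (\<forall>i. 0 < i \<and> i < n \<longrightarrow> X i \<notin> S)"
  show "return_time S X = enat n"
    unfolding return_time_def
  proof (rule antisym)
    show "Inf (enat ` {n. 0 < n \<and> X n \<in> S}) \<le> enat n" using * by (intro Inf_lower) auto
    show "enat n \<le> Inf (enat ` {n. 0 < n \<and> X n \<in> S})"
    proof (rule Inf_greatest)
      fix k assume "k \<in> enat ` {n. 0 < n \<and> X n \<in> S}"
      then obtain i where i: "k = enat i" "0 < i" "X i \<in> S" by blast
      with * have "\<not> i < n" by blast
      with i show "enat n \<le> k" by simp
    qed
  qed
qed

text \<open>Decomposition by the value n + 1 of the return time: the disjoint cylinders
  \<open>?B n\<close> have weights \<open>taboo\<close>, and paths that never return count on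
  neither side.\<close>

lemma ennreal_coarse_prob:
  assumes x: "x \<in> strong_comp \<alpha> \<omega>" and y: "y \<in> strong_comp \<alpha> \<omega>"
  shows "ennreal (coarse_prob \<alpha> \<omega> x y) = induced (step \<omega>) (strong_comp \<alpha> \<omega>) x y"
proof -
  interpret prob_space "walk_law \<omega> x" by (rule prob_space_walk_law)
  let ?S = "strong_comp \<alpha> \<omega>"
  let ?A = "\<lambda>n i. if i = Suc n then {y} else if i = 0 then UNIV else - ?S"
  let ?B = "\<lambda>n. {X. \<forall>i\<le>Suc n. X i \<in> ?A n i}"
  have B: "X \<in> ?B n \<longleftrightarrow> return_time ?S X = enat (Suc n) \<and> X (Suc n) = y" for X n
  proof
    assume X: "X \<in> ?B n"
    then have "X (Suc n) \<in> ?A n (Suc n)" by blast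
    then have "X (Suc n) = y" by simp
    moreover have "X i \<notin> ?S" if "0 < i \<and> i < Suc n" for i
    proof -
      have "X i \<in> ?A n i" using X that by (simp only: mem_Collect_eq less_imp_le)
      with that show ?thesis by simp
    qed
    ultimately show "return_time ?S X = enat (Suc n) \<and> X (Suc n) = y"
      unfolding return_time_eq_iff using y by simp
  next
    assume X: "return_time ?S X = enat (Suc n) \<and> X (Suc n) = y"
    show "X \<in> ?B n"
    proof (rule CollectI, intro allI impI)
      fix i assume "i \<le> Suc n"
      then consider "i = Suc n" | "i = 0" | "0 < i" "i < Suc n" by linarith
      then show "X i \<in> ?A n i"
        using X unfolding return_time_eq_iff by cases simp_all
    qed
  qed
  have meas: "?B n \<in> sets (walk_law \<omega> x)" for n
  proof -
    have "{X \<in> space (walk_law \<omega> x). \<forall>i\<in>{..Suc n}. X i \<in> ?A n i} \<in> sets (walk_law \<omega> x)"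
      by measurable
    then show ?thesis by (simp only: space_walk_law Ball_def atMost_iff UNIV_I simp_thms)
  qed
  have un: "{X \<in> space (walk_law \<omega> x). \<exists>n. return_time ?S X = enat n \<and> X n = y} = (\<Union>n. ?B n)"
  proof (intro set_eqI iffI)
    fix X assume "X \<in> {X \<in> space (walk_law \<omega> x). \<exists>n. return_time ?S X = enat n \<and> X n = y}"
    then obtain n where n: "return_time ?S X = enat n" "X n = y" by auto
    then have "n > 0" by (simp add: return_time_eq_iff)
    then obtain m where "n = Suc m" by (cases n) auto
    with n have "X \<in> ?B m" unfolding B by simp
    then show "X \<in> (\<Union>n. ?B n)" by blast
  next
    fix X assume "X \<in> (\<Union>n. ?B n)"
    then obtain n where "X \<in> ?B n" by blast
    then show "X \<in> {X \<in> space (walk_law \<omega> x). \<exists>n. return_time ?S X = enat n \<and> X n = y}"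
      unfolding B by auto
  qed
  have disj: "disjoint_family ?B"
    unfolding disjoint_family_on_def
  proof (intro ballI impI)
    fix m n :: nat assume "m \<noteq> n"
    have False if "X \<in> ?B m" "X \<in> ?B n" for X
      using that \<open>m \<noteq> n\<close> unfolding B by (metis enat.inject nat.inject)
    then show "?B m \<inter> ?B n = {}" by blast
  qed
  have "ennreal (coarse_prob \<alpha> \<omega> x y) = emeasure (walk_law \<omega> x) (\<Union>n. ?B n)"
    unfolding coarse_prob_def un by (simp only: emeasure_eq_measure)
  also have "\<dots> = (\<Sum>n. emeasure (walk_law \<omega> x) (?B n))"
    by (rule suminf_emeasure[OF _ disj, symmetric]) (rule image_subsetI, rule meas)
  also have "\<dots> = nsum (\<lambda>n. emeasure (walk_law \<omega> x) (?B n))"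
    by (rule nn_integral_count_space_nat[symmetric])
  also have "\<dots> = nsum (\<lambda>n. taboo (step \<omega>) ?S n x y)"
  proof (intro nn_integral_cong)
    fix n
    have "emeasure (walk_law \<omega> x) (?B n) = path_weight \<omega> (?A n) x (Suc n) y"
      by (rule emeasure_walk_path) simp
    also have "\<dots> = taboo (step \<omega>) ?S n x y"
      by (rule path_weight_taboo) auto
    finally show "emeasure (walk_law \<omega> x) (?B n) = taboo (step \<omega>) ?S n x y" .
  qed
  also have "\<dots> = induced (step \<omega>) ?S x y"
    using x y by (simp add: induced_def hit_def)
  finally show ?thesis .
qed

end

section \<open>The random conductance model\<close>

lemma nn_sym: "nn x y \<longleftrightarrow> nn y x"
  by (simp add: nn_def abs_minus_commute)

lemma nn_translate [simp]: "nn (x + z) (y + z) \<longleftrightarrow> nn x y"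
  by (simp add: nn_def)

lemma bonds_iff_nn: "{x, y} \<in> bonds \<longleftrightarrow> nn x y"
  by (auto simp: bonds_def doubleton_eq_iff nn_sym)

lemma finite_neighbours: "finite {y. nn (x :: int ^ 'd::finite) y}"
proof -
  let ?V = "UNIV :: 'd set"
  have "(\<lambda>y. (\<lambda>i. y $ i)) ` {y. nn x y} \<subseteq> PiE ?V (\<lambda>i. {x $ i - 1..x $ i + 1})"
  proof safe
    fix y i assume "nn x y"
    then have "\<bar>x $ i - y $ i\<bar> \<le> 1"
      using member_le_sum[of i ?V "\<lambda>i. \<bar>x $ i - y $ i\<bar>"] by (simp add: nn_def)
    then show "y $ i \<in> {x $ i - 1..x $ i + 1}" by auto
  qed auto
  then have "finite ((\<lambda>y. (\<lambda>i. y $ i)) ` {y. nn x y})"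
    by (rule finite_subset) (auto intro: finite_PiE)
  then show ?thesis
    by (rule finite_imageD) (auto simp: inj_on_def vec_eq_iff fun_eq_iff)
qed

lemma ex_neighbour: "\<exists>y. nn (x :: int ^ 'd::finite) y"
proof -
  fix i :: 'd
  have "nn x (x + axis i 1)"
    by (simp add: nn_def axis_def if_distrib[of abs] cong: if_cong)
  then show ?thesis ..
qed

lemma card_neighbours: "card {y. nn (x :: int ^ 'd::finite) y} = card {y. nn (0 :: int ^ 'd) y}"
proof (rule bij_betw_same_card)
  have *: "nn x y \<longleftrightarrow> nn 0 (y - x)" for y
    using nn_translate[of 0 x "y - x"] by simp
  show "bij_betw (\<lambda>y. y - x) {y. nn x y} {y. nn 0 y}"
    by (rule bij_betwI[where g = "\<lambda>y. y + x"]) (simp_all add: *)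
qed

lemma env_space_bounds:
  assumes "\<omega> \<in> space env_space" "nn x y"
  shows "0 < \<omega> {x, y}" "\<omega> {x, y} \<le> 1"
proof -
  have "\<omega> {x, y} \<in> {0<..1}"
    using assms by (auto simp: env_space_def space_PiM PiE_iff bonds_iff_nn)
  then show "0 < \<omega> {x, y}" "\<omega> {x, y} \<le> 1" by auto
qed

lemma conductance_sum_pos:
  assumes "\<omega> \<in> space env_space"
  shows "0 < conductance_sum \<omega> x"
  unfolding conductance_sum_def
  using ex_neighbour[of x] env_space_bounds[OF assms]
  by (intro sum_pos finite_neighbours) auto

lemma conductance_sum_le:
  fixes \<omega> :: "('d::finite) env"
  assumes "\<omega> \<in> space env_space"
  shows "conductance_sum \<omega> x \<le> real (card {y. nn (0 :: int ^ 'd) y})"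
proof -
  have "conductance_sum \<omega> x \<le> (\<Sum>y | nn x y. 1)"
    unfolding conductance_sum_def using env_space_bounds[OF assms] by (intro sum_mono) auto
  then show ?thesis by (simp add: card_neighbours[of x])
qed

lemma step_row_sum:
  assumes "\<omega> \<in> space env_space"
  shows "nsum (step \<omega> x) = 1"
proof -
  have "nsum (step \<omega> x) = (\<Sum>y | nn x y. ennreal (\<omega> {x, y} / conductance_sum \<omega> x))"
    by (subst nn_integral_count_space'[OF finite_neighbours[of x]]) (auto simp: trans_prob_def)
  also have "\<dots> = ennreal (\<Sum>y | nn x y. \<omega> {x, y} / conductance_sum \<omega> x)"
    using env_space_bounds[OF assms] conductance_sum_pos[OF assms, of x]
    by (intro sum_ennreal) (auto intro: less_imp_le)
  also have "\<dots> = 1"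
    using conductance_sum_pos[OF assms, of x]
    by (simp add: sum_divide_distrib[symmetric] conductance_sum_def[symmetric])
  finally show ?thesis .
qed

lemma step_reversible:
  assumes "\<omega> \<in> space env_space"
  shows "reversible (\<lambda>x. ennreal (conductance_sum \<omega> x)) (step \<omega>)"
proof -
  have "ennreal (conductance_sum \<omega> x) * step \<omega> x y = (if nn x y then ennreal (\<omega> {x, y}) else 0)" for x y
    using conductance_sum_pos[OF assms, of x] env_space_bounds[OF assms, of x y]
    by (auto simp: trans_prob_def ennreal_mult[symmetric])
  then show ?thesis
    by (simp add: reversible_def nn_sym insert_commute)
qed

section \<open>Shift covariance and measurability of the walk\<close>

lemma bonds_translate: "b \<in> bonds \<Longrightarrow> (\<lambda>y. y + z) ` b \<in> bonds"
  unfolding bonds_def by (auto, metis nn_translate)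

lemma shift_apply: "nn x y \<Longrightarrow> shift z \<omega> {x, y} = \<omega> {x + z, y + z}"
  by (simp add: shift_def bonds_iff_nn)

lemma conductance_sum_shift: "conductance_sum (shift z \<omega>) x = conductance_sum \<omega> (x + z)"
  unfolding conductance_sum_def
proof (rule sum.reindex_bij_witness[where i = "\<lambda>y. y - z" and j = "\<lambda>y. y + z"])
  fix y assume "y \<in> {y. nn (x + z) y}"
  then show "y - z \<in> {y. nn x y}" using nn_translate[of x z "y - z"] by simp
qed (auto simp: shift_apply)

lemma trans_prob_shift: "trans_prob (shift z \<omega>) x y = trans_prob \<omega> (x + z) (y + z)"
  by (simp add: trans_prob_def shift_apply conductance_sum_shift)

lemma shift_measurable: "shift z \<in> measurable env_space env_space"
  unfolding env_space_def shift_def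
proof (rule measurable_restrict)
  fix b :: "(int ^ 'a) set" assume "b \<in> bonds"
  then show "(\<lambda>\<omega>. \<omega> ((\<lambda>y. y + z) ` b))
      \<in> measurable (Pi\<^sub>M bonds (\<lambda>_. restrict_space borel {0<..1})) (restrict_space borel {0<..1})"
    by (intro measurable_component_singleton bonds_translate)
qed

lemma env_component_measurable:
  "b \<in> bonds \<Longrightarrow> (\<lambda>\<omega>. \<omega> b) \<in> borel_measurable env_space"
  unfolding env_space_def
  using measurable_component_singleton[of b bonds "\<lambda>_. restrict_space borel {0<..1::real}"]
  by (simp add: measurable_restrict_space2_iff)

lemma conductance_sum_measurable: "(\<lambda>\<omega>. conductance_sum \<omega> x) \<in> borel_measurable env_space"
  unfolding conductance_sum_def
  by (intro borel_measurable_sum env_component_measurable) (simp add: bonds_iff_nn)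

lemma trans_prob_measurable: "(\<lambda>\<omega>. trans_prob \<omega> x y) \<in> borel_measurable env_space"
proof (cases "nn x y")
  case True
  then show ?thesis
    unfolding trans_prob_def
    using env_component_measurable[of "{x, y}"] conductance_sum_measurable[of x]
    by (simp add: bonds_iff_nn)
qed (simp add: trans_prob_def)

section \<open>The strong component through finite paths\<close>

definition strong_edge :: "real \<Rightarrow> ('d::finite) env \<Rightarrow> int ^ 'd \<Rightarrow> int ^ 'd \<Rightarrow> bool" where
  "strong_edge \<alpha> \<omega> x y \<longleftrightarrow> {x, y} \<in> bonds \<and> \<alpha> \<le> \<omega> {x, y}"

definition strong_path :: "real \<Rightarrow> ('d::finite) env \<Rightarrow> (int ^ 'd) list \<Rightarrow> bool" where
  "strong_path \<alpha> \<omega> xs \<longleftrightarrow> distinct xs \<and>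
     (\<forall>i. Suc i < length xs \<longrightarrow> strong_edge \<alpha> \<omega> (xs ! i) (xs ! Suc i))"

lemma strong_comp_iff:
  "x \<in> strong_comp \<alpha> \<omega> \<longleftrightarrow> (\<exists>\<gamma>. inj \<gamma> \<and> x \<in> range \<gamma> \<and> (\<forall>k. strong_edge \<alpha> \<omega> (\<gamma> k) (\<gamma> (Suc k))))"
  by (simp add: strong_comp_def strong_edge_def)

lemma strong_path_take: "strong_path \<alpha> \<omega> xs \<Longrightarrow> strong_path \<alpha> \<omega> (take n xs)"
  by (auto simp: strong_path_def)

text \<open>The property carried along in Koenig's lemma: self-avoiding strong extensions of every
  length exist.\<close>

definition extendable :: "real \<Rightarrow> ('d::finite) env \<Rightarrow> (int ^ 'd) list \<Rightarrow> bool" where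
  "extendable \<alpha> \<omega> xs \<longleftrightarrow> (\<forall>n\<ge>length xs. \<exists>ys. length (xs @ ys) = n \<and> strong_path \<alpha> \<omega> (xs @ ys))"

text \<open>If every one-vertex extension failed at some length, a path long enough for all the
  finitely many neighbours of the last vertex would give a contradiction through one of its
  prefixes.\<close>

lemma extendable_step:
  assumes "xs \<noteq> []" and good: "extendable \<alpha> \<omega> xs"
  shows "\<exists>y. extendable \<alpha> \<omega> (xs @ [y])"
proof (rule ccontr)
  assume none: "\<not> ?thesis"
  have "\<forall>y. \<exists>n. Suc (length xs) \<le> n \<and>
      (\<forall>ys. length ((xs @ [y]) @ ys) = n \<longrightarrow> \<not> strong_path \<alpha> \<omega> ((xs @ [y]) @ ys))"
  proof
    fix y
    from none have "\<not> extendable \<alpha> \<omega> (xs @ [y])" by blast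
    then show "\<exists>n. Suc (length xs) \<le> n \<and>
      (\<forall>ys. length ((xs @ [y]) @ ys) = n \<longrightarrow> \<not> strong_path \<alpha> \<omega> ((xs @ [y]) @ ys))"
      unfolding extendable_def length_append_singleton by blast
  qed
  from choice[OF this] obtain m where m: "\<forall>y. Suc (length xs) \<le> m y \<and>
      (\<forall>ys. length ((xs @ [y]) @ ys) = m y \<longrightarrow> \<not> strong_path \<alpha> \<omega> ((xs @ [y]) @ ys))" by blast
  \<comment> \<open>Including \<open>Suc (length xs)\<close> guarantees at least one vertex beyond
    xs, even if all m y were smaller than expected.\<close>
  define N where "N = Max (insert (Suc (length xs)) (m ` {y. nn (last xs) y}))"
  have fin: "finite (insert (Suc (length xs)) (m ` {y. nn (last xs) y}))"
    by (intro finite.insertI finite_imageI finite_neighbours)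
  have "Suc (length xs) \<le> N" unfolding N_def using fin by (intro Max_ge) auto
  with good[unfolded extendable_def, rule_format, of N] obtain ys where ys: "length (xs @ ys) = N" "strong_path \<alpha> \<omega> (xs @ ys)" by auto
  with \<open>Suc (length xs) \<le> N\<close> obtain y zs where yz: "ys = y # zs" by (cases ys) auto
  have "strong_edge \<alpha> \<omega> (last xs) y"
  proof -
    have Suc: "Suc (length xs - 1) = length xs" using assms(1) by (cases xs) auto
    then have "Suc (length xs - 1) < length (xs @ ys)" using yz by simp
    then have "strong_edge \<alpha> \<omega> ((xs @ ys) ! (length xs - 1)) ((xs @ ys) ! length xs)"
      using ys(2) unfolding strong_path_def by (metis Suc)
    moreover have "(xs @ ys) ! (length xs - 1) = last xs"
      using assms(1) Suc by (simp add: nth_append last_conv_nth)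
    moreover have "(xs @ ys) ! length xs = y" using yz by simp
    ultimately show ?thesis by simp
  qed
  then have "nn (last xs) y" by (simp add: strong_edge_def bonds_iff_nn)
  then have "m y \<le> N" unfolding N_def using fin by (intro Max_ge) auto
  then have len: "length (take (m y) (xs @ ys)) = m y" using ys(1) by simp
  define d where "d = m y - Suc (length xs)"
  have d: "m y = length xs + Suc d"
    using m[rule_format, of y] by (simp add: d_def)
  have eq: "take (m y) (xs @ ys) = (xs @ [y]) @ take d zs"
    unfolding yz d by simp
  have "strong_path \<alpha> \<omega> ((xs @ [y]) @ take d zs)"
    using strong_path_take[OF ys(2), of "m y"] unfolding eq .
  moreover have "length ((xs @ [y]) @ take d zs) = m y"
    using len unfolding eq .
  ultimately show False using m by blast
qed

text \<open>Koenig's lemma: being on an infinite self-avoiding strong path is a countable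
  combination of conditions on finitely many edges.\<close>

lemma strong_comp_iff_paths:
  "x \<in> strong_comp \<alpha> \<omega> \<longleftrightarrow> (\<forall>n. \<exists>xs. length xs = Suc n \<and> hd xs = x \<and> strong_path \<alpha> \<omega> xs)"
proof
  assume "x \<in> strong_comp \<alpha> \<omega>"
  then obtain \<gamma> k where \<gamma>: "inj \<gamma>" "x = \<gamma> k" "\<And>k. strong_edge \<alpha> \<omega> (\<gamma> k) (\<gamma> (Suc k))"
    unfolding strong_comp_iff by blast
  show "\<forall>n. \<exists>xs. length xs = Suc n \<and> hd xs = x \<and> strong_path \<alpha> \<omega> xs"
  proof
    fix n
    \<comment> \<open>The infinite path may pass through x anywhere; only its part from x onwards is
      used.\<close>
    let ?xs = "map (\<lambda>i. \<gamma> (k + i)) [0..<Suc n]"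
    have nth: "?xs ! i = \<gamma> (k + i)" if "i < Suc n" for i
      using that nth_map_upt[of i "Suc n" 0 "\<lambda>i. \<gamma> (k + i)"] by (simp del: upt_Suc)
    have "inj_on (\<lambda>i. \<gamma> (k + i)) A" for A
      by (intro inj_onI) (drule injD[OF \<gamma>(1)], simp)
    then have "distinct ?xs"
      by (simp only: distinct_map distinct_upt simp_thms)
    moreover have "strong_edge \<alpha> \<omega> (?xs ! i) (?xs ! Suc i)" if "Suc i < length ?xs" for i
    proof -
      from that have "i < Suc n" "Suc i < Suc n" by simp_all
      then show ?thesis using \<gamma>(3)[of "k + i"] by (simp only: nth add_Suc_right)
    qed
    ultimately have "strong_path \<alpha> \<omega> ?xs" unfolding strong_path_def by blast
    moreover have "hd ?xs = x"
      using nth[of 0] \<gamma>(2) by (subst hd_conv_nth) simp_all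
    ultimately show "\<exists>xs. length xs = Suc n \<and> hd xs = x \<and> strong_path \<alpha> \<omega> xs"
      by (intro exI[of _ ?xs]) simp
  qed
next
  assume *: "\<forall>n. \<exists>xs. length xs = Suc n \<and> hd xs = x \<and> strong_path \<alpha> \<omega> xs"
  have "extendable \<alpha> \<omega> [x]"
    unfolding extendable_def
  proof (intro allI impI)
    fix n assume "n \<ge> length [x]"
    then obtain m where m: "n = Suc m" by (cases n) auto
    from * obtain xs where xs: "length xs = Suc m" "hd xs = x" "strong_path \<alpha> \<omega> xs" by blast
    then obtain ys where "xs = x # ys" by (cases xs) auto
    with xs m show "\<exists>ys. length ([x] @ ys) = n \<and> strong_path \<alpha> \<omega> ([x] @ ys)"
      by (intro exI[of _ ys]) simp
  qed
  \<comment> \<open>Dependent choice builds nested extendable paths; their diagonal is the infinite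
    path.\<close>
  have "\<exists>s. \<forall>n. (length (s n) = Suc n \<and> extendable \<alpha> \<omega> (s n) \<and> hd (s n) = x)
      \<and> (\<exists>y. s (Suc n) = s n @ [y])"
  proof (rule dependent_nat_choice[of "\<lambda>n xs. length xs = Suc n \<and> extendable \<alpha> \<omega> xs \<and> hd xs = x"
        "\<lambda>_ xs ys. \<exists>y. ys = xs @ [y]"])
    show "\<exists>xs. length xs = Suc 0 \<and> extendable \<alpha> \<omega> xs \<and> hd xs = x"
      using \<open>extendable \<alpha> \<omega> [x]\<close> by (intro exI[of _ "[x]"]) simp
    fix xs n assume xs: "length xs = Suc n \<and> extendable \<alpha> \<omega> xs \<and> hd xs = x"
    then have "xs \<noteq> []" by auto
    with xs obtain y where "extendable \<alpha> \<omega> (xs @ [y])" using extendable_step by blast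
    with xs \<open>xs \<noteq> []\<close> show "\<exists>ys. (length ys = Suc (Suc n) \<and> extendable \<alpha> \<omega> ys \<and> hd ys = x) \<and> (\<exists>y. ys = xs @ [y])"
      by (intro exI[of _ "xs @ [y]"]) simp
  qed
  then obtain s where s: "\<forall>n. (length (s n) = Suc n \<and> extendable \<alpha> \<omega> (s n) \<and> hd (s n) = x)
      \<and> (\<exists>y. s (Suc n) = s n @ [y])"
    by blast
  have len: "length (s n) = Suc n" and good: "extendable \<alpha> \<omega> (s n)" and hd: "hd (s n) = x"
    and ext: "\<exists>y. s (Suc n) = s n @ [y]" for n
    using s by blast+
  define \<gamma> where "\<gamma> n = s n ! n" for n
  have nth: "s n ! k = \<gamma> k" if "k \<le> n" for k n
    using that
  proof (induction n rule: dec_induct)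
    case (step n)
    obtain y where "s (Suc n) = s n @ [y]" using ext by blast
    with step len[of n] show ?case by (simp add: nth_append)
  qed (simp add: \<gamma>_def)
  have path: "strong_path \<alpha> \<omega> (s n)" for n
    using good[of n, unfolded extendable_def, rule_format, of "length (s n)"] by simp
  have "inj \<gamma>"
  proof (rule injI)
    fix i j assume "\<gamma> i = \<gamma> j"
    then have "s (max i j) ! i = s (max i j) ! j" by (simp add: nth)
    then show "i = j"
      using path[of "max i j"] len[of "max i j"] by (simp add: strong_path_def nth_eq_iff_index_eq)
  qed
  moreover have "x = \<gamma> 0"
  proof -
    have "s 0 \<noteq> []" using len[of 0] by auto
    then show ?thesis using hd[of 0] by (simp add: \<gamma>_def hd_conv_nth)
  qed
  moreover have "strong_edge \<alpha> \<omega> (\<gamma> k) (\<gamma> (Suc k))" for k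
  proof -
    have "Suc k < length (s (Suc k))" by (simp add: len)
    then have "strong_edge \<alpha> \<omega> (s (Suc k) ! k) (s (Suc k) ! Suc k)"
      using path[of "Suc k"] unfolding strong_path_def by blast
    then show ?thesis by (simp add: nth)
  qed
  ultimately show "x \<in> strong_comp \<alpha> \<omega>"
    by (auto simp: strong_comp_iff)
qed

lemma strong_comp_measurable:
  fixes x :: "int ^ 'd::finite"
  shows "Measurable.pred env_space (\<lambda>\<omega>. x \<in> strong_comp \<alpha> \<omega>)"
proof -
  have [measurable]: "Measurable.pred env_space (\<lambda>\<omega>. strong_edge \<alpha> \<omega> y z)" for y z :: "int ^ 'd"
  proof (cases "{y, z} \<in> bonds")
    case True
    note [measurable] = env_component_measurable[OF this]
    from True show ?thesis by (simp add: strong_edge_def)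
  qed (simp add: strong_edge_def)
  show ?thesis
    unfolding strong_comp_iff_paths strong_path_def by measurable
qed

lemma strong_edge_shift: "strong_edge \<alpha> (shift z \<omega>) u v \<longleftrightarrow> strong_edge \<alpha> \<omega> (u + z) (v + z)"
  by (cases "nn u v") (simp_all add: strong_edge_def bonds_iff_nn shift_apply)

lemma strong_comp_shift: "x \<in> strong_comp \<alpha> (shift z \<omega>) \<longleftrightarrow> x + z \<in> strong_comp \<alpha> \<omega>"
proof
  assume "x \<in> strong_comp \<alpha> (shift z \<omega>)"
  then obtain \<gamma> k where \<gamma>: "inj \<gamma>" "x = \<gamma> k" "\<forall>k. strong_edge \<alpha> (shift z \<omega>) (\<gamma> k) (\<gamma> (Suc k))"
    unfolding strong_comp_iff by blast
  show "x + z \<in> strong_comp \<alpha> \<omega>"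
    unfolding strong_comp_iff
  proof (intro exI conjI)
    show "inj (\<lambda>k. \<gamma> k + z)" using \<gamma>(1) by (simp add: inj_on_def)
    show "x + z \<in> range (\<lambda>k. \<gamma> k + z)" unfolding \<gamma>(2) by (rule rangeI)
    show "\<forall>k. strong_edge \<alpha> \<omega> (\<gamma> k + z) (\<gamma> (Suc k) + z)"
      using \<gamma>(3) by (simp add: strong_edge_shift)
  qed
next
  assume "x + z \<in> strong_comp \<alpha> \<omega>"
  then obtain \<gamma> k where \<gamma>: "inj \<gamma>" "x + z = \<gamma> k" "\<forall>k. strong_edge \<alpha> \<omega> (\<gamma> k) (\<gamma> (Suc k))"
    unfolding strong_comp_iff by blast
  show "x \<in> strong_comp \<alpha> (shift z \<omega>)"
    unfolding strong_comp_iff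
  proof (intro exI conjI)
    show "inj (\<lambda>k. \<gamma> k - z)" using \<gamma>(1) by (simp add: inj_on_def)
    show "x \<in> range (\<lambda>k. \<gamma> k - z)"
      by (rule range_eqI[of _ _ k]) (simp only: \<gamma>(2)[symmetric] add_diff_cancel_right')
    show "\<forall>k. strong_edge \<alpha> (shift z \<omega>) (\<gamma> k - z) (\<gamma> (Suc k) - z)"
      using \<gamma>(3) by (simp add: strong_edge_shift)
  qed
qed

lemma strong_comp_antimono: "\<alpha> \<le> \<beta> \<Longrightarrow> strong_comp \<beta> \<omega> \<subseteq> strong_comp \<alpha> \<omega>"
proof
  assume "\<alpha> \<le> \<beta>"
  then have "strong_edge \<beta> \<omega> u v \<Longrightarrow> strong_edge \<alpha> \<omega> u v" for u v
    by (simp add: strong_edge_def)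
  then show "x \<in> strong_comp \<beta> \<omega> \<Longrightarrow> x \<in> strong_comp \<alpha> \<omega>" for x
    unfolding strong_comp_iff by blast
qed

text \<open>A vertex on an infinite strong path has an outgoing edge of conductance at least
  \<alpha>. This uniform lower bound is what makes weights on the strong component
  comparable.\<close>

lemma conductance_sum_ge:
  assumes \<omega>: "\<omega> \<in> space env_space" and x: "x \<in> strong_comp \<alpha> \<omega>"
  shows "\<alpha> \<le> conductance_sum \<omega> x"
proof -
  from x obtain \<gamma> k where "x = \<gamma> k" "strong_edge \<alpha> \<omega> (\<gamma> k) (\<gamma> (Suc k))"
    unfolding strong_comp_iff by blast
  then have "nn x (\<gamma> (Suc k))" "\<alpha> \<le> \<omega> {x, \<gamma> (Suc k)}"
    by (auto simp: strong_edge_def bonds_iff_nn)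
  moreover from this have "\<omega> {x, \<gamma> (Suc k)} \<le> conductance_sum \<omega> x"
    unfolding conductance_sum_def using env_space_bounds[OF \<omega>]
    by (intro member_le_sum finite_neighbours) (auto intro: less_imp_le)
  ultimately show ?thesis by simp
qed

text \<open>Finiteness is required because \<open>infsum\<close> has the default value 0 for
  families that are not summable.\<close>

lemma ennreal_infsum:
  fixes f :: "'a \<Rightarrow> real"
  assumes "\<And>x. x \<in> A \<Longrightarrow> 0 \<le> f x" and "(\<integral>\<^sup>+x. ennreal (f x) \<partial>count_space A) < \<top>"
  shows "ennreal (infsum f A) = (\<integral>\<^sup>+x. ennreal (f x) \<partial>count_space A)"
proof -
  have "Infinite_Set_Sum.abs_summable_on f A"
    unfolding Infinite_Set_Sum.abs_summable_on_def
    using assms by (intro integrableI_nonneg) (auto simp: AE_count_space)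
  then have "(\<integral>\<^sup>+x. ennreal (f x) \<partial>count_space A) = ennreal (infsetsum f A)"
    using assms(1) by (intro nn_integral_conv_infsetsum)
  with \<open>Infinite_Set_Sum.abs_summable_on f A\<close> show ?thesis
    by (simp add: infsetsum_infsum)
qed

lemma coarse_prob_nonneg: "0 \<le> coarse_prob \<alpha> \<omega> x y"
  by (simp add: coarse_prob_def)

lemma coarse_kernel_nonneg: "0 \<le> coarse_kernel \<alpha> \<omega> n x y"
  by (induction n arbitrary: x) (auto intro!: infsum_nonneg simp: coarse_prob_nonneg)

lemma ennreal_coarse_kernel:
  assumes \<omega>: "\<omega> \<in> space env_space" and x: "x \<in> strong_comp \<alpha> \<omega>"
  shows "ennreal (coarse_kernel \<alpha> \<omega> n x y) = mpow (induced (step \<omega>) (strong_comp \<alpha> \<omega>)) n x y"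
  using x
proof (induction n arbitrary: x)
  case (Suc n)
  let ?S = "strong_comp \<alpha> \<omega>"
  let ?T = "induced (step \<omega>) ?S"
  have "(\<integral>\<^sup>+z. ennreal (coarse_prob \<alpha> \<omega> x z * coarse_kernel \<alpha> \<omega> n z y) \<partial>count_space ?S)
      = (\<integral>\<^sup>+z. ?T x z * mpow ?T n z y \<partial>count_space ?S)"
    using Suc ennreal_coarse_prob[OF step_row_sum[OF \<omega>]]
    by (intro nn_integral_cong) (simp add: ennreal_mult coarse_prob_nonneg coarse_kernel_nonneg)
  also have "\<dots> = nsum (\<lambda>z. ?T x z * mpow ?T n z y * indicator ?S z)"
    by (simp add: nn_integral_count_space_indicator)
  \<comment> \<open>Entries of \<open>induced\<close> with an endpoint outside S vanish, so summing
    over S or over the whole lattice is the same.\<close>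
  also have "\<dots> = mpow ?T (Suc n) x y"
    unfolding mpow.simps mmul_def
    by (intro nn_integral_cong) (auto simp: induced_def hit_def split: split_indicator)
  finally have eq: "(\<integral>\<^sup>+z. ennreal (coarse_prob \<alpha> \<omega> x z * coarse_kernel \<alpha> \<omega> n z y) \<partial>count_space ?S)
      = mpow ?T (Suc n) x y" .
  \<comment> \<open>Row sums at most 1 give the finiteness that \<open>ennreal_infsum\<close> asks
    for.\<close>
  have "mpow ?T (Suc n) x y \<le> nsum (mpow ?T (Suc n) x)"
    by (rule nsum_ge_point)
  also have "\<dots> \<le> 1"
    by (intro mpow_row_sum_le induced_row_sum_le step_row_sum \<omega>)
  finally have "mpow ?T (Suc n) x y < \<top>"
    by (rule le_less_trans) simp
  then have "ennreal (\<Sum>\<^sub>\<infinity>z\<in>?S. coarse_prob \<alpha> \<omega> x z * coarse_kernel \<alpha> \<omega> n z y) = mpow ?T (Suc n) x y"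
    unfolding eq[symmetric]
    by (intro ennreal_infsum mult_nonneg_nonneg coarse_prob_nonneg coarse_kernel_nonneg)
  then show ?case by (simp only: coarse_kernel.simps)
qed simp

lemma stationary_walk_strong_comp:
  assumes "A1 P"
  shows "stationary_walk P shift step (\<lambda>\<omega> x. ennreal (conductance_sum \<omega> x)) (strong_comp \<alpha>)"
proof -
  from assms have sets: "sets P = sets env_space" and distr: "\<And>z. distr P P (shift z) = P"
    by (auto simp: A1_def)
  have space: "space P = space env_space"
    by (rule sets_eq_imp_space_eq[OF sets])
  have meas: "measurable P N = measurable env_space N" for N :: "'b measure"
    by (rule measurable_cong_sets[OF sets refl])
  show ?thesis
  proof
    show "shift z \<in> measurable P P" for z
      using shift_measurable[of z] by (simp only: measurable_cong_sets[OF sets sets])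
    show "Measurable.pred P (\<lambda>\<omega>. x \<in> strong_comp \<alpha> \<omega>)" for x
      using strong_comp_measurable[of x \<alpha>] by (simp only: meas)
  qed (simp_all add: distr meas space measurable_compose[OF trans_prob_measurable measurable_ennreal]
      measurable_compose[OF conductance_sum_measurable measurable_ennreal]
      trans_prob_shift conductance_sum_shift strong_comp_shift step_row_sum step_reversible)
qed

text \<open>Conductances at most 1 make the total weight finite, so the probabilistic estimate
  applies; the rest is deterministic in each typical environment.\<close>

lemma AE_return_prob_smallo:
  fixes P :: "('d::finite) env measure"
  assumes A1: "A1 P" and \<alpha>: "\<alpha> > 0"
    and kernel: "AE \<omega> in P. 0 \<in> strong_comp \<alpha> \<omega> \<longrightarrow>
      (\<exists>c. \<forall>n\<ge>1. \<forall>y\<in>strong_comp \<alpha> \<omega>. coarse_kernel \<alpha> \<omega> n 0 y \<le> c / (real n)\<^sup>2)"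
  shows "AE \<omega> in P. 0 \<in> strong_comp \<alpha> \<omega> \<longrightarrow>
    (\<lambda>n. heat_kernel \<omega> (2 * n) 0 0) \<in> o(\<lambda>n. ln (real n) / (real n)\<^sup>2)"
proof -
  interpret stationary_walk P shift step "\<lambda>\<omega> x. ennreal (conductance_sum \<omega> x)" "strong_comp \<alpha>"
    by (rule stationary_walk_strong_comp[OF A1])
  from A1 have "prob_space P" and sets: "sets P = sets env_space" by (auto simp: A1_def)
  interpret P: prob_space P by fact
  have space: "space P = space env_space"
    by (rule sets_eq_imp_space_eq[OF sets])
  let ?d = "real (card {y. nn (0 :: int ^ 'd) y})"
  let ?b = "\<lambda>\<omega> K. birkhoff (ind \<omega>) (\<lambda>x. nsum (excess (step \<omega>) (strong_comp \<alpha> \<omega>) K x))"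
  have "(\<integral>\<^sup>+\<omega>. ennreal (conductance_sum \<omega> 0) \<partial>P) \<le> (\<integral>\<^sup>+\<omega>. ennreal ?d \<partial>P)"
    by (intro nn_integral_mono ennreal_leI conductance_sum_le) (simp add: space)
  also have "\<dots> < \<top>" by (simp add: P.emeasure_space_1)
  \<comment> \<open>Only the countably many thresholds 1 / (i + 1) are used, so that one null set
    serves every \<epsilon>.\<close>
  finally have "AE \<omega> in P. \<exists>K. \<forall>n. ?b \<omega> K n 0 \<le> of_nat n * ennreal (1 / real (Suc i))" for i
    by (intro AE_birkhoff_excess_small) (simp_all add: space conductance_sum_pos)
  then have "AE \<omega> in P. \<forall>i. \<exists>K. \<forall>n. ?b \<omega> K n 0 \<le> of_nat n * ennreal (1 / real (Suc i))"
    by (simp add: AE_all_countable)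
  with kernel AE_space show ?thesis
  proof eventually_elim
    case (elim \<omega>)
    show ?case
    proof
      assume 0: "0 \<in> strong_comp \<alpha> \<omega>"
      with elim(1) obtain c where c:
        "\<And>n y. n \<ge> 1 \<Longrightarrow> y \<in> strong_comp \<alpha> \<omega> \<Longrightarrow> coarse_kernel \<alpha> \<omega> n 0 y \<le> c / (real n)\<^sup>2"
        by blast
      have \<omega>: "\<omega> \<in> space env_space" using elim(2) by (simp add: space)
      \<comment> \<open>For D, weights are at most the number of neighbours everywhere and at least
        \<alpha> on the strong component. Taking \<open>max 0 c\<close> meets the sign condition on
        the constant.\<close>
      interpret trapped_chain "step \<omega>" "\<lambda>x. ennreal (conductance_sum \<omega> x)" "strong_comp \<alpha> \<omega>" 0
        "?d / \<alpha>" "max 0 c"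
      proof
        show "nsum (step \<omega> x) = 1" for x by (rule step_row_sum[OF \<omega>])
        show "reversible (\<lambda>x. ennreal (conductance_sum \<omega> x)) (step \<omega>)" by (rule step_reversible[OF \<omega>])
        show "ennreal (conductance_sum \<omega> 0) \<noteq> 0"
          using conductance_sum_pos[OF \<omega>, of 0] by (simp add: ennreal_eq_0_iff)
        fix y assume y: "y \<in> strong_comp \<alpha> \<omega>"
        have "conductance_sum \<omega> 0 \<le> ?d" by (rule conductance_sum_le[OF \<omega>])
        also have "?d = ?d / \<alpha> * \<alpha>" using \<alpha> by simp
        also have "\<dots> \<le> ?d / \<alpha> * conductance_sum \<omega> y"
          using \<alpha> by (intro mult_left_mono conductance_sum_ge[OF \<omega> y]) simp
        finally show "ennreal (conductance_sum \<omega> y) \<noteq> 0 \<and> ennreal (conductance_sum \<omega> y) \<noteq> \<top> \<and>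
            ennreal (conductance_sum \<omega> 0) \<le> ennreal (?d / \<alpha>) * ennreal (conductance_sum \<omega> y)"
          using conductance_sum_pos[OF \<omega>, of y] \<alpha>
          by (simp add: ennreal_eq_0_iff ennreal_mult[symmetric] ennreal_leI)
        fix n :: nat assume n: "n \<ge> 1"
        have "coarse_kernel \<alpha> \<omega> n 0 y \<le> c / (real n)\<^sup>2" by (rule c[OF n y])
        also have "\<dots> \<le> max 0 c / (real n)\<^sup>2" by (intro divide_right_mono) auto
        finally show "mpow (ind \<omega>) n 0 y \<le> ennreal (max 0 c / (real n)\<^sup>2)"
          unfolding ennreal_coarse_kernel[OF \<omega> 0, symmetric] by (rule ennreal_leI)
      qed (use 0 \<alpha> in simp_all)
      show "(\<lambda>n. heat_kernel \<omega> (2 * n) 0 0) \<in> o(\<lambda>n. ln (real n) / (real n)\<^sup>2)"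
      proof (rule return_prob_smallo)
        show "ennreal (heat_kernel \<omega> n 0 0) = mpow (step \<omega>) n 0 0" for n
          by (rule ennreal_heat_kernel) (rule step_row_sum[OF \<omega>])
        show "0 \<le> heat_kernel \<omega> n 0 0" for n by (simp add: heat_kernel_def)
        fix \<epsilon> :: real assume "\<epsilon> > 0"
        then obtain i where "1 / real (Suc i) < \<epsilon>" using nat_approx_posE by blast
        then have "of_nat l * ennreal (1 / real (Suc i)) \<le> of_nat l * ennreal \<epsilon>" for l
          by (intro mult_left_mono ennreal_leI) auto
        with elim(3) show "\<exists>K. \<forall>l. ?b \<omega> K l 0 \<le> of_nat l * ennreal \<epsilon>"
          by (meson order_trans)
      qed
    qed
  qed
qed

text \<open>Shows that the starting point 0 always satisfies the distance restriction in A4.\<close>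

lemma coarse_dist_same: "coarse_dist \<alpha> \<omega> x x = 0"
proof -
  have "coarse_dist \<alpha> \<omega> x x \<le> enat 0"
    unfolding coarse_dist_def by (intro Inf_lower) auto
  then show ?thesis by (simp flip: zero_enat_def)
qed

theorem theorem2p2:
  fixes P :: "4 env measure"
  assumes "A1 P" and "A2 P" and "A3 P" and "A4 P"
  shows "AE \<omega> in P. (\<lambda>n. heat_kernel \<omega> (2 * n) 0 0) \<in> o(\<lambda>n. ln (real n) / (real n)\<^sup>2)"
proof -
  from \<open>A1 P\<close> have "prob_space P" and sets: "sets P = sets env_space" by (auto simp: A1_def)
  interpret prob_space P by fact
  from \<open>A4 P\<close> obtain \<alpha>\<^sub>0 where \<alpha>\<^sub>0: "\<alpha>\<^sub>0 > 0" and A4: "\<And>\<alpha> \<rho>. \<alpha> \<in> {0<..<\<alpha>\<^sub>0} \<Longrightarrow> \<rho> > 0 \<Longrightarrow>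
     \<exists>C \<in> borel_measurable (cond_law P \<alpha>). AE \<omega> in cond_law P \<alpha>. \<forall>n\<ge>1.
       \<forall>x\<in>strong_comp \<alpha> \<omega>. ereal_of_enat (coarse_dist \<alpha> \<omega> 0 x) \<le> ereal (\<rho> * real n) \<longrightarrow>
         (\<forall>y\<in>strong_comp \<alpha> \<omega>.
            coarse_kernel \<alpha> \<omega> n x y \<le> C \<omega> / real n powr (real CARD(4) / 2))"
    unfolding A4_def by auto
  have "AE \<omega> in P. 0 \<in> strong_comp \<alpha> \<omega> \<longrightarrow>
      (\<lambda>n. heat_kernel \<omega> (2 * n) 0 0) \<in> o(\<lambda>n. ln (real n) / (real n)\<^sup>2)"
    if \<alpha>: "\<alpha> \<in> {0<..<\<alpha>\<^sub>0}" for \<alpha>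
  proof (rule AE_return_prob_smallo[OF \<open>A1 P\<close>])
    show "\<alpha> > 0" using \<alpha> by simp
    let ?A = "{\<omega> \<in> space P. 0 \<in> strong_comp \<alpha> \<omega>}"
    have A: "?A \<in> events"
      using strong_comp_measurable[of 0 \<alpha>]
      by (simp add: pred_def sets sets_eq_imp_space_eq[OF sets])
    \<comment> \<open>Any positive \<rho> would serve, as the estimate is applied at x = 0
      only.\<close>
    obtain C where C: "AE \<omega> in cond_law P \<alpha>. \<forall>n\<ge>1.
       \<forall>x\<in>strong_comp \<alpha> \<omega>. ereal_of_enat (coarse_dist \<alpha> \<omega> 0 x) \<le> ereal (1 * real n) \<longrightarrow>
         (\<forall>y\<in>strong_comp \<alpha> \<omega>.
            coarse_kernel \<alpha> \<omega> n x y \<le> C \<omega> / real n powr (real CARD(4) / 2))"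
      using A4[OF \<alpha>, of 1] by auto
    show "AE \<omega> in P. 0 \<in> strong_comp \<alpha> \<omega> \<longrightarrow>
      (\<exists>c. \<forall>n\<ge>1. \<forall>y\<in>strong_comp \<alpha> \<omega>. coarse_kernel \<alpha> \<omega> n 0 y \<le> c / (real n)\<^sup>2)"
    proof (cases "emeasure P ?A = 0")
      \<comment> \<open>Conditioning on a null event carries no information, but then the claim is
        vacuous almost surely.\<close>
      case True
      then have "AE \<omega> in P. \<omega> \<notin> ?A"
        using A by (intro AE_not_in) (simp add: null_sets_def)
      with AE_space show ?thesis by eventually_elim simp
    next
      case False
      have "AE \<omega> in P. \<omega> \<in> ?A \<longrightarrow> (\<forall>n\<ge>1.
       \<forall>x\<in>strong_comp \<alpha> \<omega>. ereal_of_enat (coarse_dist \<alpha> \<omega> 0 x) \<le> ereal (1 * real n) \<longrightarrow>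
         (\<forall>y\<in>strong_comp \<alpha> \<omega>.
            coarse_kernel \<alpha> \<omega> n x y \<le> C \<omega> / real n powr (real CARD(4) / 2)))"
        using C False unfolding cond_law_def
        by (subst (asm) AE_uniform_measure) (simp_all add: less_top[symmetric])
      with AE_space show ?thesis
      proof eventually_elim
        case (elim \<omega>)
        show ?case
        proof (intro impI exI allI ballI)
          fix n :: nat and y
          assume "0 \<in> strong_comp \<alpha> \<omega>" "n \<ge> 1" "y \<in> strong_comp \<alpha> \<omega>"
          with elim have "coarse_kernel \<alpha> \<omega> n 0 y \<le> C \<omega> / real n powr (real CARD(4) / 2)"
            by (simp add: coarse_dist_same)
          then show "coarse_kernel \<alpha> \<omega> n 0 y \<le> C \<omega> / (real n)\<^sup>2"
            using \<open>n \<ge> 1\<close> by simp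
        qed
      qed
    qed
  qed
  \<comment> \<open>A countable family of thresholds that tends to 0; the shift by 2 keeps them
    strictly below \<open>\<alpha>\<^sub>0\<close> already for i = 0.\<close>
  then have "AE \<omega> in P. 0 \<in> strong_comp (\<alpha>\<^sub>0 / real (i + 2)) \<omega> \<longrightarrow>
      (\<lambda>n. heat_kernel \<omega> (2 * n) 0 0) \<in> o(\<lambda>n. ln (real n) / (real n)\<^sup>2)" for i
    using \<alpha>\<^sub>0 by (simp add: divide_simps)
  then have "AE \<omega> in P. \<forall>i. 0 \<in> strong_comp (\<alpha>\<^sub>0 / real (i + 2)) \<omega> \<longrightarrow>
      (\<lambda>n. heat_kernel \<omega> (2 * n) 0 0) \<in> o(\<lambda>n. ln (real n) / (real n)\<^sup>2)"
    unfolding AE_all_countable by (rule allI)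
  moreover have "AE \<omega> in P. (\<Union>\<alpha>\<in>{0<..}. strong_comp \<alpha> \<omega>) = UNIV"
    using \<open>A2 P\<close> by (simp add: A2_def)
  ultimately show ?thesis
  proof eventually_elim
    case (elim \<omega>)
    then obtain \<alpha> where \<alpha>: "\<alpha> > 0" "0 \<in> strong_comp \<alpha> \<omega>" by auto
    \<comment> \<open>By A2 the origin is in some strong component, and components grow as the
      threshold decreases, so a threshold of the countable family below \<alpha> suffices.\<close>
    obtain i where i: "\<alpha>\<^sub>0 / \<alpha> < real i" using reals_Archimedean2 by blast
    have "\<alpha>\<^sub>0 < real i * \<alpha>" using i \<alpha>(1) by (simp add: field_simps)
    also have "\<dots> \<le> real (i + 2) * \<alpha>" using \<alpha>(1) by (intro mult_right_mono) auto
    finally have "\<alpha>\<^sub>0 / real (i + 2) \<le> \<alpha>" by (simp add: field_simps)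
    with \<alpha>(2) have "0 \<in> strong_comp (\<alpha>\<^sub>0 / real (i + 2)) \<omega>"
      using strong_comp_antimono by blast
    with elim(1) show ?case by blast
  qed
qed

end
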